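(* If a concave polygon has no two parallel sides, then it is not totally-cover-decomposable.
   Context: A polygon is concave if it is not convex. A collection of translates of a planar set $C$ is an $m$-fold covering of a point set $X$ if every point of $X$ lies in at least $m$ members; $C$ is totally-cover-decomposable if there is a constant $m$ such that for every planar point set $X$, every $m$-fold covering of $X$ by translates of $C$ can be partitioned into two subcollections each of which covers every point of $X$. *)

theory Defs
  imports "HOL-Analysis.Analysis"
begin

text \<open>
  The Euclidean plane is represented by the type \<^typ>\<open>complex\<close>, regarded as a real vector space,
  which is the type for which the library states the Jordan curve theorem.
\<close>

fun polygonal_path :: "complex list \<Rightarrow> real \<Rightarrow> complex" where
  "polygonal_path [] = linepath 0 0"
| "polygonal_path [a] = linepath a a"
| "polygonal_path [a, b] = linepath a b"
| "polygonal_path (a # b # c # vs) = linepath a b +++ polygonal_path (b # c # vs)"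

definition polygon_boundary :: "complex list \<Rightarrow> real \<Rightarrow> complex" where
  "polygon_boundary vs = polygonal_path (vs @ [hd vs])"

definition simple_polygon :: "complex list \<Rightarrow> bool" where
  "simple_polygon vs \<longleftrightarrow> length vs \<ge> 3 \<and> simple_path (polygon_boundary vs)"

definition open_polygon :: "complex list \<Rightarrow> complex set" where
  "open_polygon vs = inside (path_image (polygon_boundary vs))"

definition closed_polygon :: "complex list \<Rightarrow> complex set" where
  "closed_polygon vs = path_image (polygon_boundary vs) \<union> inside (path_image (polygon_boundary vs))"

definition side_vector :: "complex list \<Rightarrow> nat \<Rightarrow> complex" where
  "side_vector vs i = vs ! (Suc i mod length vs) - vs ! i"

text \<open>
  Side vectors of a simple polygon are nonzero, so parallelism is being real multiples of each
  other. Two sides on a common line count as parallel; in particular, angles of 180 degrees are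
  excluded.
\<close>

definition no_two_parallel_sides :: "complex list \<Rightarrow> bool" where
  "no_two_parallel_sides vs \<longleftrightarrow>
     (\<forall>i<length vs. \<forall>j<length vs. i \<noteq> j \<longrightarrow>
        \<not> (\<exists>c::real. side_vector vs i = c *\<^sub>R side_vector vs j))"

definition translates :: "complex set \<Rightarrow> complex set set" where
  "translates C = {(+) v ` C | v. True}"

text \<open>
  A point may lie in infinitely many members of a collection, hence the existential formulation
  of \<^emph>\<open>at least m members\<close> (\<^const>\<open>card\<close> is 0 on infinite sets).
\<close>

definition fold_covering :: "nat \<Rightarrow> complex set set \<Rightarrow> complex set \<Rightarrow> bool" where
  "fold_covering m F X \<longleftrightarrow>
     (\<forall>x\<in>X. \<exists>G \<subseteq> {A \<in> F. x \<in> A}. finite G \<and> card G = m)"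

text \<open>
  The two parts of the partition are allowed to be empty, which matters only when the point set
  \<open>X\<close> is empty.
\<close>

definition totally_cover_decomposable :: "complex set \<Rightarrow> bool" where
  "totally_cover_decomposable C \<longleftrightarrow>
     (\<exists>m. \<forall>X F. F \<subseteq> translates C \<and> fold_covering m F X \<longrightarrow>
        (\<exists>F1 F2. F1 \<union> F2 = F \<and> F1 \<inter> F2 = {} \<and> X \<subseteq> \<Union>F1 \<and> X \<subseteq> \<Union>F2))"

end

theory Submission
  imports Defs
begin

text \<open>
  Near an extreme vertex \<open>x\<close> of its convex hull the polygon is a convex cone; let \<open>I x\<close> be the interior
  of the dual cone. If \<open>I x\<close> and \<open>I y\<close> meet but are not nested, then the cones \<open>V\<close> at \<open>x\<close> and \<open>W\<close> at
  \<open>y\<close> lie in a common open half-plane and neither contains the other, so on a line crossing the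
  half-plane there are \<open>u \<in> V - W\<close> and \<open>w \<in> W - V\<close>, and \<open>u - w\<close> and \<open>w - u\<close> avoid both cones.
  Small translates of the polygon are then indexed by points, and a point configuration is built
  recursively: it has a set of cone positions of type \<open>V\<close>, each containing exactly \<open>k\<close> points, and one of
  type \<open>W\<close>, each containing exactly \<open>l\<close> points, and every 2-colouring makes some \<open>V\<close> position
  entirely red or some \<open>W\<close> position entirely blue. It consists of a root point, a tiny copy of the \<open>(k - 1, l)\<close>
  configuration near \<open>u\<close> and a tiny copy of the \<open>(k, l - 1)\<close> configuration near \<open>w\<close>; the root lies in
  the \<open>V\<close> positions of the former and in the \<open>W\<close> positions of the latter.

  If the sets \<open>I x\<close> are pairwise disjoint or nested, consider a maximal one, and a functional \<open>a\<close> on its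
  boundary. If \<open>a\<close> had its minimum over the polygon away from \<open>x\<close>, a perturbation of \<open>a\<close> into \<open>I x\<close>
  would have its strict minimum at some \<open>y\<close> with \<open>a \<in> I y\<close> because no two sides are parallel, and \<open>I x\<close>,
  \<open>I y\<close> would be neither disjoint nor nested. Hence both sides at \<open>x\<close> lie on supporting lines of the convex
  hull. This propagates along the boundary, and the polygon is convex.
\<close>

section \<open>Indecomposable coverings from a special pair of cones\<close>

text \<open>Otherwise iterating the translation by the nonzero vector \<open>v - w\<close>, which
  maps \<open>P\<close> into itself, would leave every bounded set. Thus distinct points index
  distinct translates, and counts of points become counts of translates.\<close>

lemma translate_eq_iff:
  fixes P :: "complex set"
  assumes "bounded P" "P \<noteq> {}"
  shows "(+) v ` P = (+) w ` P \<longleftrightarrow> v = w"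
proof
  assume eq: "(+) v ` P = (+) w ` P"
  have step: "y + (v - w) \<in> P" if "y \<in> P" for y
  proof -
    have "v + y \<in> (+) w ` P"
      using that eq by auto
    then show ?thesis
      by (auto simp: algebra_simps)
  qed
  obtain x where "x \<in> P"
    using assms(2) by auto
  have iter: "x + real n *\<^sub>R (v - w) \<in> P" for n
  proof (induction n)
    case (Suc n)
    then show ?case
      using step[OF Suc] by (simp add: algebra_simps)
  qed (simp add: \<open>x \<in> P\<close>)
  obtain b where b: "\<And>y. y \<in> P \<Longrightarrow> norm y \<le> b"
    using assms(1) by (auto simp: bounded_iff)
  have bd: "real n * norm (v - w) \<le> b + norm x" for n
  proof -
    have "real n * norm (v - w) = norm ((x + real n *\<^sub>R (v - w)) - x)"
      by simp
    also have "\<dots> \<le> norm (x + real n *\<^sub>R (v - w)) + norm x"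
      by (rule norm_triangle_ineq4)
    finally show ?thesis
      using b[OF iter[of n]] by linarith
  qed
  show "v = w"
  proof (rule ccontr)
    assume "v \<noteq> w"
    then obtain n where "b + norm x < real n * norm (v - w)"
      using reals_Archimedean3[of "norm (v - w)"] by auto
    then show False
      using bd[of n] by linarith
  qed
qed simp

lemma eventually_scaled_translate_in_open:
  fixes z :: "'a :: real_normed_vector"
  assumes "finite T" "open U" "z \<in> U"
  shows "\<forall>\<^sub>F \<epsilon> in at_right 0. \<forall>t\<in>T. z + \<epsilon> *\<^sub>R f t \<in> U"
proof (rule eventually_ball_finite[OF assms(1)], rule)
  fix t
  have "((\<lambda>\<epsilon>. z + \<epsilon> *\<^sub>R f t) \<longlongrightarrow> z + 0 *\<^sub>R f t) (at_right 0)"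
    by (intro tendsto_intros)
  then show "\<forall>\<^sub>F \<epsilon> in at_right 0. z + \<epsilon> *\<^sub>R f t \<in> U"
    using assms(2,3) by (auto intro: topological_tendstoD)
qed

text \<open>
  The membership of a point \<open>z\<close> in a cone is decided for \<open>z\<close> in the open version \<open>Vo\<close> and for
  \<open>z\<close> outside the closed version \<open>Vc\<close>; on the boundary nothing is assumed, so that open and closed
  polygons are treated alike.
\<close>

locale special_pair =
  fixes Vo Vc Wo Wc :: "complex set" and u w :: complex
  assumes open_Vo: "open Vo" and open_Wo: "open Wo"
    and closed_Vc: "closed Vc" and closed_Wc: "closed Wc"
    and Vo_Vc: "Vo \<subseteq> Vc" and Wo_Wc: "Wo \<subseteq> Wc"
    and zero_in: "0 \<in> Vc" "0 \<in> Wc"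
    and scale: "\<And>c z. 0 < c \<Longrightarrow> c *\<^sub>R z \<in> Vo \<longleftrightarrow> z \<in> Vo" "\<And>c z. 0 < c \<Longrightarrow> c *\<^sub>R z \<in> Vc \<longleftrightarrow> z \<in> Vc"
      "\<And>c z. 0 < c \<Longrightarrow> c *\<^sub>R z \<in> Wo \<longleftrightarrow> z \<in> Wo" "\<And>c z. 0 < c \<Longrightarrow> c *\<^sub>R z \<in> Wc \<longleftrightarrow> z \<in> Wc"
    and u: "u \<in> Vo" "u \<notin> Wc" and w: "w \<in> Wo" "w \<notin> Vc"
    and diff: "u - w \<notin> Vc" "u - w \<notin> Wc" "w - u \<notin> Vc" "w - u \<notin> Wc"
begin

text \<open>\<open>a - s \<in> Vo\<close> places \<open>s\<close> in the reflected cone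
  \<open>a - Vo\<close>; \<open>A\<close> and \<open>B\<close> hold the apexes of the positions of
  types \<open>V\<close> and \<open>W\<close>, and \<open>R\<close> is the set of red points. The
  relevant differences avoid \<open>Vc - Vo\<close> and \<open>Wc - Wo\<close>, so boundary points
  never decide an incidence.\<close>

definition configuration ::
    "nat \<Rightarrow> nat \<Rightarrow> complex set \<Rightarrow> complex set \<Rightarrow> complex set \<Rightarrow> bool" where
  "configuration k l S A B \<longleftrightarrow> finite S \<and> finite A \<and> finite B \<and>
     (\<forall>a\<in>A. \<forall>s\<in>S. a - s \<in> Vo \<or> a - s \<notin> Vc) \<and>
     (\<forall>b\<in>B. \<forall>s\<in>S. b - s \<in> Wo \<or> b - s \<notin> Wc) \<and>
     (\<forall>a\<in>A. card {s\<in>S. a - s \<in> Vo} = k) \<and>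
     (\<forall>b\<in>B. card {s\<in>S. b - s \<in> Wo} = l) \<and>
     (\<forall>R. (\<exists>a\<in>A. {s\<in>S. a - s \<in> Vo} \<subseteq> R) \<or> (\<exists>b\<in>B. {s\<in>S. b - s \<in> Wo} \<inter> R = {}))"

text \<open>The copies do not see each other, since \<open>u - w\<close> and \<open>w - u\<close>
  avoid both closed cones. The root \<open>0\<close> lies in exactly the \<open>V\<close> positions
  of the first copy and the \<open>W\<close> positions of the second, which raises both short counts
  by one.\<close>

lemma configuration_step:
  assumes c1: "configuration k (Suc l) S1 A1 B1" and c2: "configuration (Suc k) l S2 A2 B2"
  shows "\<exists>S A B. configuration (Suc k) (Suc l) S A B"
proof -
  note c1 = c1[unfolded configuration_def] and c2 = c2[unfolded configuration_def]
  have fin: "finite S1" "finite A1" "finite B1" "finite S2" "finite A2" "finite B2"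
    using c1 c2 by auto
  have u0: "u \<noteq> 0" and w0: "w \<noteq> 0"
    using u w zero_in by auto
  \<comment> \<open>Apart from positivity, each condition is open and holds at
    \<open>\<epsilon> = 0\<close>. In order: incidence of the root with the positions, separation of
    the copies, and distinctness of the root from the copied points, which the exact counts
    need.\<close>
  have ev: "\<forall>\<^sub>F \<epsilon> in at_right 0. 0 < \<epsilon> \<and>
      (\<forall>a\<in>A1. u + \<epsilon> *\<^sub>R a \<in> Vo) \<and> (\<forall>b\<in>B1. u + \<epsilon> *\<^sub>R b \<in> - Wc) \<and>
      (\<forall>a\<in>A2. w + \<epsilon> *\<^sub>R a \<in> - Vc) \<and> (\<forall>b\<in>B2. w + \<epsilon> *\<^sub>R b \<in> Wo) \<and>
      (\<forall>t\<in>A1 \<times> S2. (u - w) + \<epsilon> *\<^sub>R (fst t - snd t) \<in> - Vc) \<and>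
      (\<forall>t\<in>B1 \<times> S2. (u - w) + \<epsilon> *\<^sub>R (fst t - snd t) \<in> - Wc) \<and>
      (\<forall>t\<in>A2 \<times> S1. (w - u) + \<epsilon> *\<^sub>R (fst t - snd t) \<in> - Vc) \<and>
      (\<forall>t\<in>B2 \<times> S1. (w - u) + \<epsilon> *\<^sub>R (fst t - snd t) \<in> - Wc) \<and>
      (\<forall>s\<in>S1. u + \<epsilon> *\<^sub>R s \<in> - {0}) \<and> (\<forall>s\<in>S2. w + \<epsilon> *\<^sub>R s \<in> - {0})"
    using fin u w diff u0 w0 open_Vo open_Wo closed_Vc closed_Wc
    by (intro eventually_conj eventually_at_right_less eventually_scaled_translate_in_open)
      (auto simp: open_Compl)
  obtain \<epsilon> where "0 < \<epsilon>" and
      A1: "\<forall>a\<in>A1. u + \<epsilon> *\<^sub>R a \<in> Vo" and B1: "\<forall>b\<in>B1. u + \<epsilon> *\<^sub>R b \<in> - Wc" and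
      A2: "\<forall>a\<in>A2. w + \<epsilon> *\<^sub>R a \<in> - Vc" and B2: "\<forall>b\<in>B2. w + \<epsilon> *\<^sub>R b \<in> Wo" and
      A12: "\<forall>t\<in>A1 \<times> S2. (u - w) + \<epsilon> *\<^sub>R (fst t - snd t) \<in> - Vc" and
      B12: "\<forall>t\<in>B1 \<times> S2. (u - w) + \<epsilon> *\<^sub>R (fst t - snd t) \<in> - Wc" and
      A21: "\<forall>t\<in>A2 \<times> S1. (w - u) + \<epsilon> *\<^sub>R (fst t - snd t) \<in> - Vc" and
      B21: "\<forall>t\<in>B2 \<times> S1. (w - u) + \<epsilon> *\<^sub>R (fst t - snd t) \<in> - Wc" and
      nz: "\<forall>s\<in>S1. u + \<epsilon> *\<^sub>R s \<in> - {0}" "\<forall>s\<in>S2. w + \<epsilon> *\<^sub>R s \<in> - {0}"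
    using eventually_happens'[OF trivial_limit_at_right_real ev] by (elim exE conjE)
  define f g where "f = (\<lambda>z. u + \<epsilon> *\<^sub>R z)" and "g = (\<lambda>z. w + \<epsilon> *\<^sub>R z)"
  have inj: "inj f" "inj g"
    using \<open>0 < \<epsilon>\<close> by (auto simp: f_def g_def inj_def)
  have ff: "f x - f y = \<epsilon> *\<^sub>R (x - y)" and gg: "g x - g y = \<epsilon> *\<^sub>R (x - y)"
    and fg: "f x - g y = (u - w) + \<epsilon> *\<^sub>R (x - y)" and gf: "g x - f y = (w - u) + \<epsilon> *\<^sub>R (x - y)"
    for x y by (simp_all add: f_def g_def algebra_simps)
  have sc: "f x - f y \<in> Vo \<longleftrightarrow> x - y \<in> Vo" "f x - f y \<in> Vc \<longleftrightarrow> x - y \<in> Vc"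
    "f x - f y \<in> Wo \<longleftrightarrow> x - y \<in> Wo" "f x - f y \<in> Wc \<longleftrightarrow> x - y \<in> Wc"
    "g x - g y \<in> Vo \<longleftrightarrow> x - y \<in> Vo" "g x - g y \<in> Vc \<longleftrightarrow> x - y \<in> Vc"
    "g x - g y \<in> Wo \<longleftrightarrow> x - y \<in> Wo" "g x - g y \<in> Wc \<longleftrightarrow> x - y \<in> Wc" for x y
    unfolding ff gg by (simp_all add: scale \<open>0 < \<epsilon>\<close>)
  have cross: "a \<in> A1 \<Longrightarrow> s \<in> S2 \<Longrightarrow> f a - g s \<notin> Vc" "b \<in> B1 \<Longrightarrow> s \<in> S2 \<Longrightarrow> f b - g s \<notin> Wc"
    "a \<in> A2 \<Longrightarrow> s \<in> S1 \<Longrightarrow> g a - f s \<notin> Vc" "b \<in> B2 \<Longrightarrow> s \<in> S1 \<Longrightarrow> g b - f s \<notin> Wc" for a b s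
    using A12 B12 A21 B21 by (auto simp: fg gf)
  have root: "a \<in> A1 \<Longrightarrow> f a \<in> Vo" "b \<in> B1 \<Longrightarrow> f b \<notin> Wc" "a \<in> A2 \<Longrightarrow> g a \<notin> Vc"
    "b \<in> B2 \<Longrightarrow> g b \<in> Wo" for a b
    using A1 B1 A2 B2 by (auto simp: f_def g_def)
  have decided: "a \<in> A1 \<Longrightarrow> s \<in> S1 \<Longrightarrow> a - s \<in> Vc \<Longrightarrow> a - s \<in> Vo"
    "b \<in> B1 \<Longrightarrow> s \<in> S1 \<Longrightarrow> b - s \<in> Wc \<Longrightarrow> b - s \<in> Wo"
    "a \<in> A2 \<Longrightarrow> s \<in> S2 \<Longrightarrow> a - s \<in> Vc \<Longrightarrow> a - s \<in> Vo"
    "b \<in> B2 \<Longrightarrow> s \<in> S2 \<Longrightarrow> b - s \<in> Wc \<Longrightarrow> b - s \<in> Wo" for a b s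
    using c1 c2 by blast+
  have nz: "0 \<notin> f ` S1" "0 \<notin> g ` S2"
    using nz by (auto simp: f_def g_def)
  define S where "S = insert 0 (f ` S1 \<union> g ` S2)"
  have EA1: "{s\<in>S. f a - s \<in> Vo} = insert 0 (f ` {s\<in>S1. a - s \<in> Vo})" if "a \<in> A1" for a
    using that root(1) cross(1) Vo_Vc by (auto simp: S_def sc)
  have EA2: "{s\<in>S. g a - s \<in> Vo} = g ` {s\<in>S2. a - s \<in> Vo}" if "a \<in> A2" for a
    using that root(3) cross(3) Vo_Vc by (auto simp: S_def sc)
  have EB1: "{s\<in>S. f b - s \<in> Wo} = f ` {s\<in>S1. b - s \<in> Wo}" if "b \<in> B1" for b
    using that root(2) cross(2) Wo_Wc by (auto simp: S_def sc)
  have EB2: "{s\<in>S. g b - s \<in> Wo} = insert 0 (g ` {s\<in>S2. b - s \<in> Wo})" if "b \<in> B2" for b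
    using that root(4) cross(4) Wo_Wc by (auto simp: S_def sc)
  have fS: "finite {s\<in>S1. Q s}" "finite {s\<in>S2. Q s}" for Q
    using fin by auto
  have n0: "0 \<notin> f ` {s\<in>S1. Q s}" "0 \<notin> g ` {s\<in>S2. Q s}" for Q
    using nz by auto
  have inj_on: "inj_on f T" "inj_on g T" for T
    using inj by (auto intro: inj_on_subset)
  have "configuration (Suc k) (Suc l) S (f ` A1 \<union> g ` A2) (f ` B1 \<union> g ` B2)"
    unfolding configuration_def
  proof (intro conjI allI)
    show "finite S" "finite (f ` A1 \<union> g ` A2)" "finite (f ` B1 \<union> g ` B2)"
      using fin by (auto simp: S_def)
    show "\<forall>a\<in>f ` A1 \<union> g ` A2. \<forall>s\<in>S. a - s \<in> Vo \<or> a - s \<notin> Vc"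
      using decided root cross by (auto simp: S_def sc)
    show "\<forall>b\<in>f ` B1 \<union> g ` B2. \<forall>s\<in>S. b - s \<in> Wo \<or> b - s \<notin> Wc"
      using decided root cross by (auto simp: S_def sc)
    show "\<forall>a\<in>f ` A1 \<union> g ` A2. card {s \<in> S. a - s \<in> Vo} = Suc k"
      using c1 c2 by (auto simp: EA1 EA2 card_image inj_on fS n0)
    show "\<forall>b\<in>f ` B1 \<union> g ` B2. card {s \<in> S. b - s \<in> Wo} = Suc l"
      using c1 c2 by (auto simp: EB1 EB2 card_image inj_on fS n0)
  next
    fix R
    show "(\<exists>a\<in>f ` A1 \<union> g ` A2. {s \<in> S. a - s \<in> Vo} \<subseteq> R) \<or>
          (\<exists>b\<in>f ` B1 \<union> g ` B2. {s \<in> S. b - s \<in> Wo} \<inter> R = {})"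
    \<comment> \<open>A red root keeps the red \<open>V\<close> positions of the first copy red and
      is absent from its \<open>W\<close> positions. A blue root acts likewise on the second copy
      with the types exchanged.\<close>
    proof (cases "0 \<in> R")
      case True
      have "(\<exists>a\<in>A1. {s \<in> S1. a - s \<in> Vo} \<subseteq> f -` R) \<or> (\<exists>b\<in>B1. {s \<in> S1. b - s \<in> Wo} \<inter> f -` R = {})"
        using c1 by blast
      then show ?thesis
      proof
        assume "\<exists>a\<in>A1. {s \<in> S1. a - s \<in> Vo} \<subseteq> f -` R"
        then obtain a where a: "a \<in> A1" "{s \<in> S1. a - s \<in> Vo} \<subseteq> f -` R" by blast
        then have "{s \<in> S. f a - s \<in> Vo} \<subseteq> R"
          using True by (auto simp: EA1)
        with a show ?thesis by blast
      next
        assume "\<exists>b\<in>B1. {s \<in> S1. b - s \<in> Wo} \<inter> f -` R = {}"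
        then obtain b where b: "b \<in> B1" "{s \<in> S1. b - s \<in> Wo} \<inter> f -` R = {}" by blast
        then have "{s \<in> S. f b - s \<in> Wo} \<inter> R = {}"
          by (auto simp: EB1)
        with b show ?thesis by blast
      qed
    next
      case False
      have "(\<exists>a\<in>A2. {s \<in> S2. a - s \<in> Vo} \<subseteq> g -` R) \<or> (\<exists>b\<in>B2. {s \<in> S2. b - s \<in> Wo} \<inter> g -` R = {})"
        using c2 by blast
      then show ?thesis
      proof
        assume "\<exists>a\<in>A2. {s \<in> S2. a - s \<in> Vo} \<subseteq> g -` R"
        then obtain a where a: "a \<in> A2" "{s \<in> S2. a - s \<in> Vo} \<subseteq> g -` R" by blast
        then have "{s \<in> S. g a - s \<in> Vo} \<subseteq> R"
          by (auto simp: EA2)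
        with a show ?thesis by blast
      next
        assume "\<exists>b\<in>B2. {s \<in> S2. b - s \<in> Wo} \<inter> g -` R = {}"
        then obtain b where b: "b \<in> B2" "{s \<in> S2. b - s \<in> Wo} \<inter> g -` R = {}" by blast
        then have "{s \<in> S. g b - s \<in> Wo} \<inter> R = {}"
          using False by (auto simp: EB2)
        with b show ?thesis by blast
      qed
    qed
  qed
  then show ?thesis
    by blast
qed

text \<open>If \<open>k = 0\<close>, a \<open>V\<close> position without points is vacuously red; if
  \<open>l = 0\<close>, a \<open>W\<close> position without points is vacuously blue.\<close>

lemma configuration_exists: "\<exists>S A B. configuration k l S A B"
proof (induction "k + l" arbitrary: k l)
  case 0
  have "configuration 0 0 {} {0} {}"
    by (simp add: configuration_def)
  with 0 show ?case by auto
next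
  case (Suc n)
  consider "k = 0" | "l = 0" | k' l' where "k = Suc k'" "l = Suc l'"
    by (metis not0_implies_Suc)
  then show ?case
  proof cases
    case 1
    then have "configuration k l {} {0} {}"
      by (simp add: configuration_def)
    then show ?thesis by blast
  next
    case 2
    then have "configuration k l {} {} {0}"
      by (simp add: configuration_def)
    then show ?thesis by blast
  next
    case 3
    then show ?thesis
      using Suc.hyps configuration_step[of k' l'] by (metis add_Suc add_Suc_right nat.inject)
  qed
qed

text \<open>Duality turns the points \<open>s\<close> into translates of \<open>P\<close>, and the
  positions into points near \<open>p\<close> and \<open>q\<close>. A partition of the translates
  colours \<open>S\<close>, and a suitable monochromatic position is a point that one part
  misses.\<close>

lemma not_totally_cover_decomposable:
  fixes P :: "complex set"
  assumes P: "bounded P" "P \<noteq> {}" and "0 < r"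
    and p: "\<And>z. norm z < r \<Longrightarrow> z \<in> Vo \<Longrightarrow> p + z \<in> P" "\<And>z. norm z < r \<Longrightarrow> z \<notin> Vc \<Longrightarrow> p + z \<notin> P"
    and q: "\<And>z. norm z < r \<Longrightarrow> z \<in> Wo \<Longrightarrow> q + z \<in> P" "\<And>z. norm z < r \<Longrightarrow> z \<notin> Wc \<Longrightarrow> q + z \<notin> P"
  shows "\<not> totally_cover_decomposable P"
proof
  assume "totally_cover_decomposable P"
  then obtain m where m: "\<forall>X F. F \<subseteq> translates P \<and> fold_covering m F X \<longrightarrow>
        (\<exists>F1 F2. F1 \<union> F2 = F \<and> F1 \<inter> F2 = {} \<and> X \<subseteq> \<Union>F1 \<and> X \<subseteq> \<Union>F2)"
    unfolding totally_cover_decomposable_def by (elim exE)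
  obtain S A B where conf: "configuration m m S A B"
    using configuration_exists by blast
  note c = conf[unfolded configuration_def]
  have fin: "finite S" "finite A" "finite B"
    using c by auto
  have "\<forall>\<^sub>F \<epsilon> in at_right 0. 0 < \<epsilon> \<and> (\<forall>t\<in>(A \<union> B) \<times> S. 0 + \<epsilon> *\<^sub>R (fst t - snd t) \<in> ball 0 r)"
    using fin \<open>0 < r\<close>
    by (intro eventually_conj eventually_at_right_less eventually_scaled_translate_in_open) auto
  then obtain \<epsilon> where "0 < \<epsilon>" and \<epsilon>: "\<forall>t\<in>(A \<union> B) \<times> S. 0 + \<epsilon> *\<^sub>R (fst t - snd t) \<in> ball 0 r"
    using eventually_happens'[OF trivial_limit_at_right_real] by blast
  have small: "norm (\<epsilon> *\<^sub>R (a - s)) < r" if "a \<in> A \<union> B" "s \<in> S" for a s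
    using \<epsilon> that by (auto simp del: norm_scaleR)
  define T where "T s = (+) (\<epsilon> *\<^sub>R s) ` P" for s
  have T_inj: "inj_on T S'" for S'
    using \<open>0 < \<epsilon>\<close> by (auto simp: inj_on_def T_def translate_eq_iff[OF P])
  have T_iff: "x + \<epsilon> *\<^sub>R a \<in> T s \<longleftrightarrow> x + \<epsilon> *\<^sub>R (a - s) \<in> P" for x a s
    by (auto simp: T_def image_iff algebra_simps intro!: bexI[of _ "x + \<epsilon> *\<^sub>R (a - s)"])
  have TA: "p + \<epsilon> *\<^sub>R a \<in> T s \<longleftrightarrow> a - s \<in> Vo" if "a \<in> A" "s \<in> S" for a s
    unfolding T_iff using p[OF small[of a s]] c that Vo_Vc scale[OF \<open>0 < \<epsilon>\<close>] by blast
  have TB: "q + \<epsilon> *\<^sub>R b \<in> T s \<longleftrightarrow> b - s \<in> Wo" if "b \<in> B" "s \<in> S" for b s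
    unfolding T_iff using q[OF small[of b s]] c that Wo_Wc scale[OF \<open>0 < \<epsilon>\<close>] by blast
  define X where "X = (\<lambda>a. p + \<epsilon> *\<^sub>R a) ` A \<union> (\<lambda>b. q + \<epsilon> *\<^sub>R b) ` B"
  have "fold_covering m (T ` S) X"
    unfolding fold_covering_def
  proof
    fix x assume "x \<in> X"
    then consider a where "a \<in> A" "x = p + \<epsilon> *\<^sub>R a" | b where "b \<in> B" "x = q + \<epsilon> *\<^sub>R b"
      unfolding X_def by blast
    then show "\<exists>G\<subseteq>{D \<in> T ` S. x \<in> D}. finite G \<and> card G = m"
    proof cases
      case 1
      then show ?thesis
        using c fin by (intro exI[of _ "T ` {s\<in>S. a - s \<in> Vo}"]) (auto simp: card_image T_inj TA)
    next
      case 2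
      then show ?thesis
        using c fin by (intro exI[of _ "T ` {s\<in>S. b - s \<in> Wo}"]) (auto simp: card_image T_inj TB)
    qed
  qed
  moreover have "T ` S \<subseteq> translates P"
    by (auto simp: translates_def T_def)
  ultimately obtain F1 F2 where F: "F1 \<union> F2 = T ` S" "F1 \<inter> F2 = {}" "X \<subseteq> \<Union>F1" "X \<subseteq> \<Union>F2"
    using m[rule_format, of "T ` S" X] by metis
  have sub: "F1 \<subseteq> T ` S" "F2 \<subseteq> T ` S"
    using F(1) by auto
  \<comment> \<open>The translates in \<open>F1\<close> count as red. A red \<open>V\<close>
    position gives a point outside \<open>\<Union>F2\<close>, a blue \<open>W\<close> position one
    outside \<open>\<Union>F1\<close>.\<close>
  have "(\<exists>a\<in>A. {s \<in> S. a - s \<in> Vo} \<subseteq> T -` F1) \<or> (\<exists>b\<in>B. {s \<in> S. b - s \<in> Wo} \<inter> T -` F1 = {})"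
    using c by blast
  then show False
  proof
    assume "\<exists>a\<in>A. {s \<in> S. a - s \<in> Vo} \<subseteq> T -` F1"
    then obtain a where a: "a \<in> A" "{s \<in> S. a - s \<in> Vo} \<subseteq> T -` F1" by blast
    then have "p + \<epsilon> *\<^sub>R a \<in> \<Union>F2"
      using F(4) by (auto simp: X_def)
    then obtain s where "s \<in> S" "T s \<in> F2" "p + \<epsilon> *\<^sub>R a \<in> T s"
      using sub by auto
    then show False
      using TA[OF a(1)] a(2) F(2) by blast
  next
    assume "\<exists>b\<in>B. {s \<in> S. b - s \<in> Wo} \<inter> T -` F1 = {}"
    then obtain b where b: "b \<in> B" "{s \<in> S. b - s \<in> Wo} \<inter> T -` F1 = {}" by blast
    then have "q + \<epsilon> *\<^sub>R b \<in> \<Union>F1"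
      using F(3) by (auto simp: X_def)
    then obtain s where "s \<in> S" "T s \<in> F1" "q + \<epsilon> *\<^sub>R b \<in> T s"
      using sub by auto
    then show False
      using TB[OF b(1)] b(2) by blast
  qed
qed

end

section \<open>Normal cones of the vertices\<close>

lemma collinear_of_common_normal:
  fixes h d z :: complex
  assumes "h \<noteq> 0" "d \<noteq> 0" "h \<bullet> d = 0" "h \<bullet> z = 0"
  obtains c :: real where "z = c *\<^sub>R d"
proof -
  have hd: "Re h * Re d + Im h * Im d = 0" and hz: "Re h * Re z + Im h * Im z = 0"
    using assms by (simp_all add: inner_complex_def)
  have "Re h * (Re d * Im z - Im d * Re z) = 0" "Im h * (Re d * Im z - Im d * Re z) = 0"
    using hd hz by algebra+
  then have cr: "Re d * Im z = Im d * Re z"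
    using assms(1) by (auto simp: complex_eq_iff)
  show ?thesis
  proof (cases "Re d = 0")
    case True
    then have "Im d \<noteq> 0"
      using assms(2) by (auto simp: complex_eq_iff)
    then show ?thesis
      using True cr by (intro that[of "Im z / Im d"]) (auto simp: complex_eq_iff)
  next
    case False
    then show ?thesis
      using cr by (intro that[of "Re z / Re d"]) (auto simp: complex_eq_iff field_simps)
  qed
qed

lemma exists_inner_normal:
  fixes d e :: complex
  assumes "\<not> (\<exists>c::real. e = c *\<^sub>R d)" "d \<noteq> 0"
  obtains b where "b \<bullet> d = 0" "0 < b \<bullet> e"
proof -
  have perp: "(\<i> * d) \<bullet> d = 0"
    by (simp add: inner_complex_def)
  then have "(\<i> * d) \<bullet> e \<noteq> 0"
    using assms collinear_of_common_normal[of "\<i> * d" d e] by auto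
  then show ?thesis
    using perp that[of "\<i> * d"] that[of "- (\<i> * d)"] by (cases "0 < (\<i> * d) \<bullet> e") auto
qed

text \<open>Up to positive factors, \<open>b1\<close> and \<open>b2\<close> are the coordinates
  along \<open>e\<close> and \<open>d\<close>, so the two inequalities on \<open>z\<close> describe
  the closed cone spanned by \<open>d\<close> and \<open>e\<close>.\<close>

lemma inner_ge_of_dual:
  fixes b1 b2 d e g z :: complex
  assumes "b1 \<bullet> d = 0" "0 < b1 \<bullet> e" "b2 \<bullet> e = 0" "0 < b2 \<bullet> d"
    and "0 < g \<bullet> d" "0 < g \<bullet> e" and "0 \<le> b1 \<bullet> z" "0 \<le> b2 \<bullet> z" "z \<noteq> 0"
  shows "0 < g \<bullet> z"
proof -
  have n: "b1 \<noteq> 0" "b2 \<noteq> 0" "d \<noteq> 0" "e \<noteq> 0"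
    using assms by auto
  have "b1 \<bullet> (z - (b1 \<bullet> z / (b1 \<bullet> e)) *\<^sub>R e) = 0"
    using assms(2) by (simp add: inner_diff_right)
  then obtain c where c: "z - (b1 \<bullet> z / (b1 \<bullet> e)) *\<^sub>R e = c *\<^sub>R d"
    using collinear_of_common_normal[of b1 d] n assms(1) by blast
  then have z: "z = (b1 \<bullet> z / (b1 \<bullet> e)) *\<^sub>R e + c *\<^sub>R d"
    by (simp add: algebra_simps)
  have "b2 \<bullet> z = c * (b2 \<bullet> d)"
    by (subst z) (simp add: inner_add_right assms(3))
  then have "0 \<le> c"
    using assms(4,8) by (simp add: zero_le_mult_iff)
  moreover have "0 \<le> b1 \<bullet> z / (b1 \<bullet> e)"
    using assms(2,7) by simp
  moreover have "c \<noteq> 0 \<or> b1 \<bullet> z / (b1 \<bullet> e) \<noteq> 0"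
    using z assms(9) by fastforce
  moreover have "g \<bullet> z = (b1 \<bullet> z / (b1 \<bullet> e)) * (g \<bullet> e) + c * (g \<bullet> d)"
    by (subst z) (simp add: inner_add_right)
  ultimately show ?thesis
    using assms(5,6) by (metis add_nonneg_pos add_pos_nonneg less_eq_real_def mult_nonneg_nonneg mult_pos_pos)
qed

text \<open>Minimise \<open>a\<close> first and break ties by \<open>b\<close>. Independence makes
  the minimiser unique, and a small enough weight on \<open>b\<close> lets a single functional
  select it strictly.\<close>

lemma lexicographic_minimum:
  fixes V :: "complex set" and a b :: complex
  assumes "finite V" "V \<noteq> {}" and indep: "\<And>z. a \<bullet> z = 0 \<Longrightarrow> b \<bullet> z = 0 \<Longrightarrow> z = 0"
  obtains y \<epsilon> where "y \<in> V" "\<forall>z\<in>V. a \<bullet> y \<le> a \<bullet> z"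
    "\<forall>z\<in>V. a \<bullet> z = a \<bullet> y \<longrightarrow> b \<bullet> y \<le> b \<bullet> z"
    "0 < \<epsilon>" "\<forall>z\<in>V - {y}. 0 < (a + \<epsilon> *\<^sub>R b) \<bullet> (z - y)"
proof -
  define T where "T = {y\<in>V. \<forall>z\<in>V. a \<bullet> y \<le> a \<bullet> z}"
  have "T \<noteq> {}"
    using ex_is_arg_min_if_finite[OF assms(1,2), of "(\<bullet>) a"]
    by (auto simp: T_def is_arg_min_linorder)
  moreover have "finite T"
    using assms(1) by (simp add: T_def)
  ultimately obtain y where y: "y \<in> T" "\<And>z. z \<in> T \<Longrightarrow> b \<bullet> y \<le> b \<bullet> z"
    using ex_is_arg_min_if_finite[of T "(\<bullet>) b"] by (auto simp: is_arg_min_linorder)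
  have yV: "y \<in> V" and ya: "\<And>z. z \<in> V \<Longrightarrow> a \<bullet> y \<le> a \<bullet> z"
    using y(1) by (auto simp: T_def)
  have yb: "b \<bullet> y \<le> b \<bullet> z" if "z \<in> V" "a \<bullet> z = a \<bullet> y" for z
    using that ya by (intro y(2)) (auto simp: T_def)
  have "\<forall>\<^sub>F \<epsilon> in at_right 0. \<forall>z\<in>V - {y}. 0 < (a + \<epsilon> *\<^sub>R b) \<bullet> (z - y)"
  proof (rule eventually_ball_finite, use assms(1) in simp, rule)
    fix z assume z: "z \<in> V - {y}"
    show "\<forall>\<^sub>F \<epsilon> in at_right 0. 0 < (a + \<epsilon> *\<^sub>R b) \<bullet> (z - y)"
    proof (cases "a \<bullet> z = a \<bullet> y")
      case True
      then have 0: "a \<bullet> (z - y) = 0"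
        by (simp add: inner_diff_right)
      then have "b \<bullet> (z - y) \<noteq> 0"
        using indep[of "z - y"] z by auto
      then have "0 < b \<bullet> (z - y)"
        using yb[of z] z True by (auto simp: inner_diff_right)
      with 0 show ?thesis
        by (auto simp: inner_add_left eventually_at_right_less intro: eventually_mono[OF eventually_at_right_less])
    next
      case False
      then have "0 < (a + 0 *\<^sub>R b) \<bullet> (z - y)"
        using ya[of z] z by (auto simp: inner_diff_right)
      moreover have "((\<lambda>\<epsilon>. (a + \<epsilon> *\<^sub>R b) \<bullet> (z - y)) \<longlongrightarrow> (a + 0 *\<^sub>R b) \<bullet> (z - y)) (at_right 0)"
        by (intro tendsto_intros)
      ultimately show ?thesis
        by (rule order_tendstoD(1)[rotated])
    qed
  qed
  then have "\<forall>\<^sub>F \<epsilon> in at_right 0. 0 < \<epsilon> \<and> (\<forall>z\<in>V - {y}. 0 < (a + \<epsilon> *\<^sub>R b) \<bullet> (z - y))"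
    by (intro eventually_conj eventually_at_right_less)
  then obtain \<epsilon> where "0 < \<epsilon>" "\<forall>z\<in>V - {y}. 0 < (a + \<epsilon> *\<^sub>R b) \<bullet> (z - y)"
    using eventually_happens'[OF trivial_limit_at_right_real] by blast
  then show ?thesis
    using that[of y \<epsilon>] yV ya yb by simp
qed

text \<open>
  A vector \<open>h\<close> stands for the linear functional \<^term>\<open>\<lambda>z. h \<bullet> z\<close>. Below, \<open>local_normals x\<close>
  consists of the functionals that have a strict local minimum over the polygon at the vertex \<open>x\<close>,
  and \<open>global_normals x\<close> of those that have their strict global minimum there; the latter set is
  nonempty iff \<open>x\<close> is an extreme point of the convex hull.
\<close>

locale polygon_graph =
  fixes V :: "complex set" and nb :: "complex \<Rightarrow> complex set"
  assumes finite_V: "finite V" and nonempty_V: "V \<noteq> {}"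
    and nb_two: "\<And>x. x \<in> V \<Longrightarrow> \<exists>a b. a \<in> V \<and> b \<in> V \<and> nb x = {a, b} \<and> a \<noteq> b"
    and nb_irrefl: "\<And>x. x \<in> V \<Longrightarrow> x \<notin> nb x"
    and no_parallel: "\<And>x x' y y' c::real. \<lbrakk>x \<in> V; x' \<in> V; y \<in> nb x; y' \<in> nb x';
        y - x = c *\<^sub>R (y' - x')\<rbrakk> \<Longrightarrow> {x, y} = {x', y'}"
    and nb_connected: "\<And>U. \<lbrakk>U \<subseteq> V; U \<noteq> {}; \<And>x. x \<in> U \<Longrightarrow> nb x \<subseteq> U\<rbrakk> \<Longrightarrow> U = V"
begin

definition local_normals :: "complex \<Rightarrow> complex set" where
  "local_normals x = {h. \<forall>y\<in>nb x. 0 < h \<bullet> (y - x)}"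

definition global_normals :: "complex \<Rightarrow> complex set" where
  "global_normals x = {h. \<forall>y\<in>V - {x}. 0 < h \<bullet> (y - x)}"

lemma nb_subset: "x \<in> V \<Longrightarrow> nb x \<subseteq> V - {x}"
  using nb_two nb_irrefl by fastforce

lemma global_subset_local: "x \<in> V \<Longrightarrow> global_normals x \<subseteq> local_normals x"
  using nb_subset by (auto simp: local_normals_def global_normals_def)

text \<open>The two sides at \<open>x\<close> are not parallel, so each has a normal that is
  positive on the other; together \<open>b1\<close> and \<open>b2\<close> cut out the cone spanned
  by the sides.\<close>

lemma obtain_dual:
  assumes "x \<in> V" "d \<in> nb x"
  obtains e b1 b2 where "nb x = {d, e}" "d \<noteq> e" "b1 \<bullet> (d - x) = 0" "0 < b1 \<bullet> (e - x)"
    "b2 \<bullet> (e - x) = 0" "0 < b2 \<bullet> (d - x)"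
proof -
  obtain e where e: "nb x = {d, e}" "d \<noteq> e"
    using nb_two[OF assms(1)] assms(2) by (metis insertE insert_commute singletonD)
  have "x \<noteq> d" "x \<noteq> e"
    using nb_irrefl assms(1) e by auto
  then have "d - x \<noteq> 0" "e - x \<noteq> 0" by auto
  moreover have "\<not> (\<exists>c::real. e - x = c *\<^sub>R (d - x))" "\<not> (\<exists>c::real. d - x = c *\<^sub>R (e - x))"
    using no_parallel[of x x e d] no_parallel[of x x d e] assms(1) e by (auto simp: doubleton_eq_iff)
  ultimately show ?thesis
    using exists_inner_normal[of "e - x" "d - x"] exists_inner_normal[of "d - x" "e - x"] e that
    by metis
qed

definition supports :: "complex \<Rightarrow> complex \<Rightarrow> bool" where
  "supports h x \<longleftrightarrow> (\<forall>z\<in>V. 0 \<le> h \<bullet> (z - x))"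

section \<open>Consequences of nested or disjoint normal cones\<close>

context
  assumes nested: "\<And>x y. \<lbrakk>x \<in> V; y \<in> V; global_normals x \<noteq> {}; global_normals y \<noteq> {};
      local_normals x \<inter> local_normals y \<noteq> {}\<rbrakk> \<Longrightarrow>
      local_normals x \<subseteq> local_normals y \<or> local_normals y \<subseteq> local_normals x"
begin

text \<open>If \<open>a\<close> had a lower minimum, at \<open>j\<close>, a side at \<open>j\<close>
  orthogonal to \<open>a\<close> would be parallel and hence equal to the side from \<open>x\<close>
  to \<open>y\<close>, where \<open>a\<close> is larger. So \<open>a\<close> would lie in
  \<open>local_normals j\<close>, which nesting and maximality place inside
  \<open>local_normals x\<close>; but \<open>a\<close> vanishes on a side at
  \<open>x\<close>.\<close>

lemma maximal_supports:
  assumes x: "x \<in> V" "global_normals x \<noteq> {}"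
    and max: "\<And>y. \<lbrakk>y \<in> V; global_normals y \<noteq> {}; local_normals x \<subseteq> local_normals y\<rbrakk> \<Longrightarrow>
      local_normals y = local_normals x"
    and y: "y \<in> nb x" "a \<bullet> (y - x) = 0" "a \<noteq> 0"
    and a: "\<And>z. z \<in> nb x \<Longrightarrow> 0 \<le> a \<bullet> (z - x)"
  shows "supports a x"
proof (rule ccontr)
  assume "\<not> supports a x"
  then obtain z where z: "z \<in> V" "a \<bullet> (z - x) < 0"
    by (auto simp: supports_def not_le)
  have xy: "y - x \<noteq> 0"
    using nb_irrefl x(1) y(1) by auto
  \<comment> \<open>Perturbing by \<open>b\<close> moves \<open>a\<close> from the boundary into
    \<open>local_normals x\<close>; being positive on \<open>y - x\<close>, \<open>b\<close> is
    independent of \<open>a\<close>.\<close>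
  obtain b where b: "b \<in> local_normals x"
    using x global_subset_local by blast
  have indep: "w = 0" if "a \<bullet> w = 0" "b \<bullet> w = 0" for w
  proof -
    obtain c where "w = c *\<^sub>R (y - x)"
      using collinear_of_common_normal[OF y(3) xy y(2) \<open>a \<bullet> w = 0\<close>] .
    then show ?thesis
      using that(2) b y(1) by (auto simp: local_normals_def)
  qed
  obtain j \<epsilon> where j: "j \<in> V" "\<forall>z\<in>V. a \<bullet> j \<le> a \<bullet> z"
      "\<forall>z\<in>V. a \<bullet> z = a \<bullet> j \<longrightarrow> b \<bullet> j \<le> b \<bullet> z"
    and \<epsilon>: "0 < \<epsilon>" "\<forall>z\<in>V - {j}. 0 < (a + \<epsilon> *\<^sub>R b) \<bullet> (z - j)"
    by (rule lexicographic_minimum[OF finite_V nonempty_V indep])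
  have jx: "a \<bullet> j < a \<bullet> x"
    using bspec[OF j(2) z(1)] z(2) by (simp add: inner_diff_right)
  have gj: "a + \<epsilon> *\<^sub>R b \<in> global_normals j"
    using \<epsilon>(2) by (simp add: global_normals_def)
  moreover have "a + \<epsilon> *\<^sub>R b \<in> local_normals x"
    using a b \<epsilon>(1) by (auto simp: local_normals_def inner_add_left intro!: add_nonneg_pos)
  ultimately have "local_normals x \<subseteq> local_normals j \<or> local_normals j \<subseteq> local_normals x"
    using global_subset_local[OF j(1)] by (intro nested x j(1)) auto
  then have sub: "local_normals j \<subseteq> local_normals x"
    using max[OF j(1)] gj by blast
  have "a \<in> local_normals j"
    unfolding local_normals_def
  proof (intro CollectI ballI)
    fix k assume k: "k \<in> nb j"
    then have "k \<in> V"
      using nb_subset j(1) by auto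
    then have "0 \<le> a \<bullet> (k - j)"
      using bspec[OF j(2), of k] by (simp add: inner_diff_right)
    moreover have "a \<bullet> (k - j) \<noteq> 0"
    proof
      assume 0: "a \<bullet> (k - j) = 0"
      then obtain c where "k - j = c *\<^sub>R (y - x)"
        using collinear_of_common_normal[OF y(3) xy y(2)] by blast
      then have "{j, k} = {x, y}"
        using no_parallel j(1) x(1) k y(1) by blast
      then have "x = j \<or> x = k" by blast
      then show False
        using 0 jx by (auto simp: inner_diff_right)
    qed
    ultimately show "0 < a \<bullet> (k - j)" by simp
  qed
  then have "0 < a \<bullet> (y - x)"
    using sub y(1) by (auto simp: local_normals_def)
  then show False
    using y(2) by simp
qed

text \<open>Both boundary functionals are supporting, so all of \<open>V\<close> lies in the cone
  spanned by the sides at \<open>x\<close>, and positivity on these sides extends to every other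
  vertex.\<close>

lemma maximal_local_eq_global:
  assumes x: "x \<in> V" "global_normals x \<noteq> {}"
    and max: "\<And>y. \<lbrakk>y \<in> V; global_normals y \<noteq> {}; local_normals x \<subseteq> local_normals y\<rbrakk> \<Longrightarrow>
      local_normals y = local_normals x"
  shows "local_normals x \<subseteq> global_normals x"
proof
  fix g assume g: "g \<in> local_normals x"
  obtain d where "d \<in> nb x"
    using nb_two[OF x(1)] by auto
  then obtain e b1 b2 where b: "nb x = {d, e}" "d \<noteq> e" "b1 \<bullet> (d - x) = 0" "0 < b1 \<bullet> (e - x)"
    "b2 \<bullet> (e - x) = 0" "0 < b2 \<bullet> (d - x)"
    using obtain_dual[OF x(1)] by metis
  have "supports b1 x"
    by (rule maximal_supports[OF x max, of d]) (use b in auto)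
  moreover have "supports b2 x"
    by (rule maximal_supports[OF x max, of e]) (use b in auto)
  ultimately show "g \<in> global_normals x"
    using b g inner_ge_of_dual[of b1 "d - x" "e - x" b2 g]
    by (auto simp: global_normals_def local_normals_def supports_def)
qed

text \<open>Enlarge \<open>local_normals x\<close> to a maximal \<open>local_normals m\<close>,
  which equals \<open>global_normals m\<close>. A functional in \<open>global_normals x\<close> then
  has a strict minimum at both \<open>x\<close> and \<open>m\<close>, so \<open>x = m\<close>: every
  extreme vertex is maximal.\<close>

lemma local_eq_global_and_maximal:
  assumes x: "x \<in> V" "global_normals x \<noteq> {}"
  shows "local_normals x = global_normals x"
    and "\<And>y. \<lbrakk>y \<in> V; global_normals y \<noteq> {}; local_normals x \<subseteq> local_normals y\<rbrakk> \<Longrightarrow>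
      local_normals y = local_normals x"
proof -
  define L where "L = local_normals ` {y\<in>V. global_normals y \<noteq> {}}"
  have "finite L" "local_normals x \<in> L"
    using finite_V x by (auto simp: L_def)
  from finite_has_maximal2[OF this] obtain M where M: "M \<in> L" "local_normals x \<subseteq> M"
    "\<forall>b\<in>L. M \<subseteq> b \<longrightarrow> M = b"
    by (elim bexE conjE)
  then obtain m where m: "m \<in> V" "global_normals m \<noteq> {}" "M = local_normals m"
    unfolding L_def by blast
  have max: "local_normals y = local_normals m"
    if "y \<in> V" "global_normals y \<noteq> {}" "local_normals m \<subseteq> local_normals y" for y
    using M(3) m(3) that by (auto simp: L_def)
  have "local_normals m \<subseteq> global_normals m"
    by (rule maximal_local_eq_global[OF m(1,2) max])
  then have sub: "global_normals x \<subseteq> global_normals m"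
    using M(2) m(3) global_subset_local[OF x(1)] by blast
  have "x = m"
  proof (rule ccontr)
    assume "x \<noteq> m"
    obtain g where "g \<in> global_normals x" "g \<in> global_normals m"
      using x(2) sub by blast
    then have "0 < g \<bullet> (m - x)" "0 < g \<bullet> (x - m)"
      using \<open>x \<noteq> m\<close> x(1) m(1) by (auto simp: global_normals_def)
    then show False
      by (simp add: inner_diff_right)
  qed
  then show "local_normals x = global_normals x"
    and "\<And>y. \<lbrakk>y \<in> V; global_normals y \<noteq> {}; local_normals x \<subseteq> local_normals y\<rbrakk> \<Longrightarrow>
      local_normals y = local_normals x"
    using max \<open>local_normals m \<subseteq> global_normals m\<close> global_subset_local[OF x(1)] by auto
qed

lemma extreme_edge_supports:
  assumes x: "x \<in> V" "global_normals x \<noteq> {}" and d: "d \<in> nb x"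
  shows "\<exists>a. a \<noteq> 0 \<and> a \<bullet> (d - x) = 0 \<and> supports a x"
proof -
  obtain e b1 b2 where b: "nb x = {d, e}" "b1 \<bullet> (d - x) = 0" "0 < b1 \<bullet> (e - x)"
    using obtain_dual[OF x(1) d] by metis
  have "supports b1 x"
    by (rule maximal_supports[OF x local_eq_global_and_maximal(2)[OF x], of d]) (use b in auto)
  then show ?thesis
    using b by (intro exI[of _ b1]) auto
qed

text \<open>Tilting the supporting functional \<open>a\<close> by \<open>- b\<close> selects an
  extreme vertex \<open>j\<close> on the line through \<open>x\<close> and \<open>y\<close>, other
  than \<open>x\<close>. If no side at \<open>j\<close> lay on this line, \<open>a\<close> would
  have a strict minimum at \<open>j\<close>, yet it takes the same value at \<open>x\<close>. That
  side must be the one from \<open>x\<close> to \<open>y\<close>, so \<open>j = y\<close>.\<close>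

lemma extreme_neighbour:
  assumes x: "x \<in> V" "global_normals x \<noteq> {}" and y: "y \<in> nb x"
  shows "global_normals y \<noteq> {}"
proof -
  obtain a where a: "a \<noteq> 0" "a \<bullet> (y - x) = 0" "supports a x"
    using extreme_edge_supports[OF x y] by blast
  have xy: "y - x \<noteq> 0" and "y \<in> V"
    using nb_subset x(1) y(1) by auto
  obtain b where b: "b \<in> local_normals x"
    using x global_subset_local by blast
  have b_pos: "0 < b \<bullet> (y - x)"
    using b y by (auto simp: local_normals_def)
  have indep: "w = 0" if "a \<bullet> w = 0" "(- b) \<bullet> w = 0" for w
  proof -
    obtain c where "w = c *\<^sub>R (y - x)"
      using collinear_of_common_normal[OF a(1) xy a(2) \<open>a \<bullet> w = 0\<close>] .
    then show ?thesis
      using that(2) b_pos by auto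
  qed
  obtain j \<epsilon> where j: "j \<in> V" "\<forall>z\<in>V. a \<bullet> j \<le> a \<bullet> z"
      "\<forall>z\<in>V. a \<bullet> z = a \<bullet> j \<longrightarrow> (- b) \<bullet> j \<le> (- b) \<bullet> z"
    and \<epsilon>: "0 < \<epsilon>" "\<forall>z\<in>V - {j}. 0 < (a + \<epsilon> *\<^sub>R (- b)) \<bullet> (z - j)"
    by (rule lexicographic_minimum[OF finite_V nonempty_V indep])
  have aj: "a \<bullet> j = a \<bullet> x"
    using bspec[OF j(2) x(1)] a(3) j(1) by (auto simp: supports_def inner_diff_right)
  then have "j \<noteq> x"
    using bspec[OF j(3) \<open>y \<in> V\<close>] a(2) b_pos by (auto simp: inner_diff_right)
  have gj: "global_normals j \<noteq> {}"
    using \<epsilon>(2) by (auto simp: global_normals_def)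
  have "\<exists>k\<in>nb j. a \<bullet> (k - j) = 0"
  proof (rule ccontr)
    assume "\<not> (\<exists>k\<in>nb j. a \<bullet> (k - j) = 0)"
    moreover have "0 \<le> a \<bullet> (k - j)" if "k \<in> nb j" for k
      using bspec[OF j(2), of k] that nb_subset[OF j(1)] by (auto simp: inner_diff_right)
    ultimately have "a \<in> local_normals j"
      by (force simp: local_normals_def)
    then have "a \<in> global_normals j"
      using local_eq_global_and_maximal(1)[OF j(1) gj] by simp
    then have "0 < a \<bullet> (x - j)"
      using x(1) \<open>j \<noteq> x\<close> by (auto simp: global_normals_def)
    then show False
      using aj by (simp add: inner_diff_right)
  qed
  then obtain k where k: "k \<in> nb j" "a \<bullet> (k - j) = 0"
    by blast
  then obtain c where "k - j = c *\<^sub>R (y - x)"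
    using collinear_of_common_normal[OF a(1) xy a(2)] by blast
  then have "{j, k} = {x, y}"
    using no_parallel j(1) x(1) k(1) y by blast
  then show ?thesis
    using \<open>j \<noteq> x\<close> gj by auto
qed

text \<open>Minimising the real part and then the imaginary part gives one extreme vertex;
  connectedness carries the property to all.\<close>

lemma all_extreme: "x \<in> V \<Longrightarrow> global_normals x \<noteq> {}"
proof -
  have indep: "z = 0" if "1 \<bullet> z = 0" "\<i> \<bullet> z = 0" for z :: complex
    using that by (simp add: inner_complex_def complex_eq_iff)
  obtain j \<epsilon> where j: "j \<in> V" "\<forall>z\<in>V. 1 \<bullet> j \<le> 1 \<bullet> z"
      "\<forall>z\<in>V. 1 \<bullet> z = 1 \<bullet> j \<longrightarrow> \<i> \<bullet> j \<le> \<i> \<bullet> z"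
    and "0 < \<epsilon>" "\<forall>z\<in>V - {j}. 0 < (1 + \<epsilon> *\<^sub>R \<i>) \<bullet> (z - j)"
    by (rule lexicographic_minimum[OF finite_V nonempty_V indep])
  then have "global_normals j \<noteq> {}"
    by (auto simp: global_normals_def)
  with j(1) have "{x\<in>V. global_normals x \<noteq> {}} \<noteq> {}"
    by auto
  then have "{x\<in>V. global_normals x \<noteq> {}} = V"
  proof (rule nb_connected[rotated])
    fix x assume x: "x \<in> {x\<in>V. global_normals x \<noteq> {}}"
    then show "nb x \<subseteq> {x\<in>V. global_normals x \<noteq> {}}"
      using extreme_neighbour[of x] nb_subset[of x] by auto
  qed auto
  then show "x \<in> V \<Longrightarrow> global_normals x \<noteq> {}"
    by blast
qed

theorem edges_support:
  assumes "x \<in> V" "y \<in> nb x"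
  obtains a where "a \<noteq> 0" "a \<bullet> (y - x) = 0" "supports a x"
  using extreme_edge_supports[OF assms(1) all_extreme assms(2)] assms(1) by blast

end

end

section \<open>The shape of a polygon near its extreme vertices\<close>

lemma nonneg_of_perturbed_nonneg:
  fixes p q :: real
  assumes "\<And>t. 0 < t \<Longrightarrow> 0 \<le> p + t * q"
  shows "0 \<le> p"
proof -
  have "((\<lambda>t. p + t * q) \<longlongrightarrow> p + 0 * q) (at_right 0)"
    by (intro tendsto_intros)
  moreover have "\<forall>\<^sub>F t in at_right 0. 0 \<le> p + t * q"
    using assms by (auto intro: eventually_mono[OF eventually_at_right_less])
  ultimately show ?thesis
    by (simp add: tendsto_lowerbound)
qed

text \<open>As the limit of \<open>d + t *\<^sub>R e\<close> in the first open cone,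
  \<open>d\<close> lies in the second closed cone, where \<open>g\<close> is positive away from 0.
  Inclusion of cones thus reverses inclusion of dual cones.\<close>

lemma inner_pos_of_cone_subset:
  fixes b1 b2 c1 c2 d e d' e' g :: complex
  assumes b: "b1 \<bullet> d = 0" "0 < b1 \<bullet> e" "b2 \<bullet> e = 0" "0 < b2 \<bullet> d"
    and c: "c1 \<bullet> d' = 0" "0 < c1 \<bullet> e'" "c2 \<bullet> e' = 0" "0 < c2 \<bullet> d'"
    and sub: "{z. 0 < b1 \<bullet> z \<and> 0 < b2 \<bullet> z} \<subseteq> {z. 0 \<le> c1 \<bullet> z \<and> 0 \<le> c2 \<bullet> z}"
    and g: "0 < g \<bullet> d'" "0 < g \<bullet> e'"
  shows "0 < g \<bullet> d"
proof -
  have "0 \<le> c1 \<bullet> (d + t *\<^sub>R e) \<and> 0 \<le> c2 \<bullet> (d + t *\<^sub>R e)" if "0 < t" for t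
    using that b by (intro CollectD[OF subsetD[OF sub]]) (simp add: inner_add_right)
  then have "0 \<le> c1 \<bullet> d" "0 \<le> c2 \<bullet> d"
    using nonneg_of_perturbed_nonneg[of "c1 \<bullet> d" "c1 \<bullet> e"]
      nonneg_of_perturbed_nonneg[of "c2 \<bullet> d" "c2 \<bullet> e"] by (auto simp: inner_add_right)
  moreover have "d \<noteq> 0"
    using b by auto
  ultimately show ?thesis
    by (rule inner_ge_of_dual[OF c g])
qed

text \<open>\<open>inside S\<close> is a union of components of the complement of \<open>S\<close>,
  and \<open>T\<close> lies in a single one.\<close>

lemma connected_disjoint_inside:
  fixes S :: "'a :: real_normed_vector set"
  assumes "connected T" "T \<inter> S = {}" "p \<in> T" "p \<notin> inside S"
  shows "T \<inter> inside S = {}"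
proof -
  have "y \<notin> inside S" if "y \<in> T" for y
  proof
    assume "y \<in> inside S"
    moreover have "connected_component (- S) y p"
      using assms that unfolding connected_component_def by blast
    ultimately show False
      using assms(4) inside_same_component by blast
  qed
  then show ?thesis by blast
qed

lemma inside_subset_convex_superset:
  fixes S :: "complex set"
  assumes "convex K" "S \<subseteq> K"
  shows "inside S \<subseteq> K"
  using outside_subset_convex[OF assms] by (auto simp: inside_outside)

locale polygon_curve = polygon_graph +
  fixes G :: "complex set"
  assumes G_eq: "G = (\<Union>x\<in>V. \<Union>y\<in>nb x. closed_segment x y)"
    and nb_sym: "\<And>x y. x \<in> V \<Longrightarrow> y \<in> nb x \<Longrightarrow> x \<in> nb y"
    and vertex_off: "\<And>x y z. \<lbrakk>x \<in> V; y \<in> V; z \<in> nb y; x \<in> closed_segment y z\<rbrakk> \<Longrightarrow> x = y \<or> x = z"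
    and Jordan: "inside G \<noteq> {}" "open (inside G)" "bounded (inside G)" "frontier (inside G) = G"
    and compact_G: "compact G"
begin

text \<open>A small ball around \<open>x\<close> minus the two sides splits into a sector and a
  connected remainder. The remainder has a point outside a half-plane containing \<open>G\<close>,
  so it misses the inside; as \<open>x\<close> is a frontier point, the sector meets the inside and
  hence lies in it.\<close>

lemma local_shape:
  assumes x: "x \<in> V" "global_normals x \<noteq> {}"
    and de: "nb x = {d, e}"
    and b: "b1 \<bullet> (d - x) = 0" "0 < b1 \<bullet> (e - x)" "b2 \<bullet> (e - x) = 0" "0 < b2 \<bullet> (d - x)"
  obtains r where "0 < r"
    "\<forall>z. norm z < r \<longrightarrow> 0 < b1 \<bullet> z \<and> 0 < b2 \<bullet> z \<longrightarrow> x + z \<in> inside G"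
    "\<forall>z. norm z < r \<longrightarrow> \<not> (0 \<le> b1 \<bullet> z \<and> 0 \<le> b2 \<bullet> z) \<longrightarrow> x + z \<notin> G \<union> inside G"
proof -
  obtain h where h: "h \<in> global_normals x"
    using x(2) by auto
  define K where "K = {z. h \<bullet> z \<ge> h \<bullet> x}"
  have "convex K"
    unfolding K_def by (rule convex_halfspace_ge)
  have VK: "V \<subseteq> K"
  proof
    fix z assume "z \<in> V"
    then show "z \<in> K"
      using h by (cases "z = x") (auto simp: K_def global_normals_def inner_diff_right intro: less_imp_le)
  qed
  have "G \<subseteq> K"
    unfolding G_eq
  proof (intro UN_least)
    fix y z assume "y \<in> V" "z \<in> nb y"
    then show "closed_segment y z \<subseteq> K"
      using VK nb_subset[of y] by (intro closed_segment_subset \<open>convex K\<close>) auto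
  qed
  then have "inside G \<subseteq> K"
    by (rule inside_subset_convex_superset[OF \<open>convex K\<close>])
  \<comment> \<open>The sides not ending at \<open>x\<close> form a closed set missing
    \<open>x\<close>, so \<open>ball x r0\<close> meets only the two sides at
    \<open>x\<close>.\<close>
  define Q where "Q = (\<Union>y\<in>V. \<Union>z\<in>nb y. if x = y \<or> x = z then {} else closed_segment y z)"
  have fin_nb: "finite (nb y)" if "y \<in> V" for y
    using nb_subset[OF that] finite_V by (auto intro: finite_subset)
  have "closed Q"
    unfolding Q_def by (intro closed_UN finite_V fin_nb ballI) auto
  moreover have "x \<notin> Q"
    using vertex_off[OF x(1)] by (auto simp: Q_def split: if_splits)
  ultimately obtain r0 where r0: "0 < r0" "ball x r0 \<subseteq> - Q"
    using open_contains_ball[of "- Q"] by (auto simp: open_Compl)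
  have de_V: "d \<in> V" "e \<in> V" "d \<noteq> x" "e \<noteq> x"
    using nb_subset[OF x(1)] de by auto
  \<comment> \<open>Keeping \<open>r\<close> below both side lengths makes the bounding rays of the
    sector, within the ball, part of \<open>G\<close>.\<close>
  define r where "r = min r0 (min (norm (d - x)) (norm (e - x)))"
  have r: "0 < r" "r \<le> r0" "r \<le> norm (d - x)" "r \<le> norm (e - x)"
    using r0(1) de_V by (auto simp: r_def)
  define S where "S = ball x r \<inter> {y. b1 \<bullet> y > b1 \<bullet> x} \<inter> {y. b2 \<bullet> y > b2 \<bullet> x}"
  define S1 where "S1 = ball x r \<inter> {y. b1 \<bullet> y < b1 \<bullet> x}"
  define S2 where "S2 = ball x r \<inter> {y. b2 \<bullet> y < b2 \<bullet> x}"
  have conv: "convex S" "convex S1" "convex S2"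
    unfolding S_def S1_def S2_def
    by (intro convex_Int convex_ball convex_halfspace_lt convex_halfspace_gt)+
  have G_ball: "b1 \<bullet> x \<le> b1 \<bullet> y \<and> b2 \<bullet> x \<le> b2 \<bullet> y \<and> (b1 \<bullet> y = b1 \<bullet> x \<or> b2 \<bullet> y = b2 \<bullet> x)"
    if y: "y \<in> G" "y \<in> ball x r" for y
  proof -
    obtain p q where pq: "p \<in> V" "q \<in> nb p" "y \<in> closed_segment p q"
      using y(1) by (auto simp: G_eq)
    have "y \<in> ball x r0"
      using y(2) r(2) by simp
    then have "y \<notin> Q"
      using r0(2) by blast
    then have "x = p \<or> x = q"
      using pq by (auto simp: Q_def)
    then obtain s where s: "s \<in> nb x" "y \<in> closed_segment x s"
      using pq nb_sym closed_segment_commute by blast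
    then obtain t where t: "0 \<le> t" "y = x + t *\<^sub>R (s - x)"
      by (auto simp: in_segment algebra_simps)
    have "b1 \<bullet> y = b1 \<bullet> x + t * (b1 \<bullet> (s - x))" "b2 \<bullet> y = b2 \<bullet> x + t * (b2 \<bullet> (s - x))"
      unfolding t(2) by (simp_all add: inner_add_right)
    moreover have "s = d \<or> s = e"
      using s(1) de by auto
    ultimately show ?thesis
      using b t(1) by auto
  qed
  have disj: "S \<inter> G = {}" "(S1 \<union> S2) \<inter> G = {}"
    using G_ball by (fastforce simp: S_def S1_def S2_def)+
  \<comment> \<open>This direction makes \<open>b1\<close>, \<open>b2\<close> and \<open>h\<close>
    all negative, so the scaled point links \<open>S1\<close> with \<open>S2\<close> and lies
    outside \<open>K\<close>.\<close>
  define w where "w = - ((d - x) + (e - x))"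
  define \<delta> where "\<delta> = r / (norm w + 1)"
  have \<delta>: "0 < \<delta>"
    using r(1) by (simp add: \<delta>_def add_nonneg_pos)
  have "norm (\<delta> *\<^sub>R w) < r"
  proof -
    have "0 < norm w + 1"
      by (simp add: add_nonneg_pos)
    then show ?thesis
      using r(1) by (simp add: \<delta>_def pos_divide_less_eq algebra_simps)
  qed
  moreover have w_neg: "b1 \<bullet> w < 0" "b2 \<bullet> w < 0"
    unfolding w_def inner_minus_right inner_add_right using b by simp_all
  ultimately have p: "x + \<delta> *\<^sub>R w \<in> S1" "x + \<delta> *\<^sub>R w \<in> S2"
    using \<delta> by (auto simp: S1_def S2_def dist_norm inner_add_right mult_pos_neg)
  have "0 < h \<bullet> (d - x)" "0 < h \<bullet> (e - x)"
    using h de_V by (auto simp: global_normals_def)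
  then have "h \<bullet> w < 0"
    unfolding w_def inner_minus_right inner_add_right by simp
  then have "x + \<delta> *\<^sub>R w \<notin> K"
    using \<delta> by (auto simp: K_def inner_add_right mult_pos_neg not_le)
  then have "x + \<delta> *\<^sub>R w \<notin> inside G"
    using \<open>inside G \<subseteq> K\<close> by blast
  moreover have "connected (S1 \<union> S2)"
    using p conv by (intro connected_Un convex_connected) auto
  ultimately have out: "(S1 \<union> S2) \<inter> inside G = {}"
    using connected_disjoint_inside[OF _ disj(2)] p by blast
  have "x \<in> frontier (inside G)"
    unfolding Jordan(4) using x(1) de by (auto simp: G_eq)
  then obtain y where y: "y \<in> inside G" "y \<in> ball x r"
    using r(1) by (auto simp: frontier_straddle)
  have "y \<in> S"
  proof (rule ccontr)
    assume "y \<notin> S"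
    moreover have "y \<notin> S1" "y \<notin> S2"
      using out y(1) by auto
    ultimately have "(b1 \<bullet> (y - x) = 0 \<and> 0 \<le> b2 \<bullet> (y - x)) \<or> (b2 \<bullet> (y - x) = 0 \<and> 0 \<le> b1 \<bullet> (y - x))"
      using y(2) by (auto simp: S_def S1_def S2_def inner_diff_right)
    moreover have "y \<in> G" if s: "\<beta> \<bullet> (s - x) = 0" "\<beta> \<bullet> (y - x) = 0" "0 < \<gamma> \<bullet> (s - x)" "0 \<le> \<gamma> \<bullet> (y - x)"
      "\<beta> \<noteq> 0" "s \<in> nb x" "r \<le> norm (s - x)" for \<beta> \<gamma> s
    proof -
      have "s - x \<noteq> 0"
        using s(3) by auto
      then obtain c where c: "y - x = c *\<^sub>R (s - x)"
        using collinear_of_common_normal s(1,2,5) by blast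
      then have "0 \<le> c"
        using s(3,4) by (simp add: zero_le_mult_iff)
      moreover have "norm (y - x) < norm (s - x)"
        using y(2) s(7) by (simp add: dist_norm norm_minus_commute)
      then have "c * norm (s - x) < 1 * norm (s - x)"
        using c \<open>0 \<le> c\<close> by simp
      then have "c \<le> 1"
        using mult_right_less_imp_less by fastforce
      moreover have "y = (1 - c) *\<^sub>R x + c *\<^sub>R s"
        using c by (simp add: algebra_simps)
      ultimately have "y \<in> closed_segment x s"
        by (auto simp: in_segment)
      then show ?thesis
        using x(1) s(6) by (auto simp: G_eq)
    qed
    ultimately have "y \<in> G"
      using b r de by (metis inner_zero_left insertCI less_irrefl)
    then show False
      using y(1) by (auto simp: inside_outside)
  qed
  have "S \<subseteq> inside G"
  proof
    fix q assume "q \<in> S"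
    show "q \<in> inside G"
      using connected_disjoint_inside[OF convex_connected[OF conv(1)] disj(1) \<open>q \<in> S\<close>] \<open>y \<in> S\<close> y(1)
      by blast
  qed
  have "x + z \<in> inside G" if "norm z < r" "0 < b1 \<bullet> z" "0 < b2 \<bullet> z" for z
  proof -
    have "x + z \<in> S"
      using that by (auto simp: S_def dist_norm inner_add_right)
    then show ?thesis
      using \<open>S \<subseteq> inside G\<close> by blast
  qed
  moreover have "x + z \<notin> G \<union> inside G" if "norm z < r" "\<not> (0 \<le> b1 \<bullet> z \<and> 0 \<le> b2 \<bullet> z)" for z
  proof -
    have "x + z \<in> S1 \<union> S2"
      using that by (auto simp: S1_def S2_def dist_norm inner_add_right)
    then show ?thesis
      using disj(2) out by blast
  qed
  ultimately show ?thesis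
    using r(1) by (intro that) auto
qed

text \<open>By duality the cones at \<open>x\<close> and \<open>y\<close> are not nested either,
  which gives \<open>u0\<close> and \<open>w0\<close>; a common functional \<open>h\<close> puts
  both cones, apart from 0, in an open half-plane.\<close>

lemma indecomposable_of_crossing_normals:
  assumes x: "x \<in> V" "global_normals x \<noteq> {}" and y: "y \<in> V" "global_normals y \<noteq> {}"
    and meet: "local_normals x \<inter> local_normals y \<noteq> {}"
    and not_sub: "\<not> local_normals x \<subseteq> local_normals y" "\<not> local_normals y \<subseteq> local_normals x"
    and P: "P = inside G \<or> P = G \<union> inside G"
  shows "\<not> totally_cover_decomposable P"
proof -
  obtain d e b1 b2 where de: "nb x = {d, e}" and b: "b1 \<bullet> (d - x) = 0" "0 < b1 \<bullet> (e - x)"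
    "b2 \<bullet> (e - x) = 0" "0 < b2 \<bullet> (d - x)"
    using nb_two[OF x(1)] obtain_dual[OF x(1)] by (metis insertI1)
  obtain d' e' c1 c2 where de': "nb y = {d', e'}" and c: "c1 \<bullet> (d' - y) = 0" "0 < c1 \<bullet> (e' - y)"
    "c2 \<bullet> (e' - y) = 0" "0 < c2 \<bullet> (d' - y)"
    using nb_two[OF y(1)] obtain_dual[OF y(1)] by (metis insertI1)
  define Vo where "Vo = {z. 0 < b1 \<bullet> z \<and> 0 < b2 \<bullet> z}"
  define Vc where "Vc = {z. 0 \<le> b1 \<bullet> z \<and> 0 \<le> b2 \<bullet> z}"
  define Wo where "Wo = {z. 0 < c1 \<bullet> z \<and> 0 < c2 \<bullet> z}"
  define Wc where "Wc = {z. 0 \<le> c1 \<bullet> z \<and> 0 \<le> c2 \<bullet> z}"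
  note defs = Vo_def Vc_def Wo_def Wc_def
  have "\<not> Vo \<subseteq> Wc"
  proof
    assume sub: "Vo \<subseteq> Wc"
    have "local_normals y \<subseteq> local_normals x"
      using inner_pos_of_cone_subset[OF b c sub[unfolded defs]]
        inner_pos_of_cone_subset[OF b(3,4,1,2) c, unfolded conj_commute[of "0 < b2 \<bullet> _"], OF sub[unfolded defs]]
      by (auto simp: local_normals_def de de')
    then show False
      using not_sub by blast
  qed
  then obtain u0 where u0: "u0 \<in> Vo" "u0 \<notin> Wc" by blast
  have "\<not> Wo \<subseteq> Vc"
  proof
    assume sub: "Wo \<subseteq> Vc"
    have "local_normals x \<subseteq> local_normals y"
      using inner_pos_of_cone_subset[OF c b sub[unfolded defs]]
        inner_pos_of_cone_subset[OF c(3,4,1,2) b, unfolded conj_commute[of "0 < c2 \<bullet> _"], OF sub[unfolded defs]]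
      by (auto simp: local_normals_def de de')
    then show False
      using not_sub by blast
  qed
  then obtain w0 where w0: "w0 \<in> Wo" "w0 \<notin> Vc" by blast
  obtain h where h: "h \<in> local_normals x" "h \<in> local_normals y"
    using meet by blast
  have h_V: "0 < h \<bullet> z" if "z \<in> Vc" "z \<noteq> 0" for z
    by (rule inner_ge_of_dual[OF b]) (use that h(1) de in \<open>auto simp: local_normals_def Vc_def\<close>)
  have h_W: "0 < h \<bullet> z" if "z \<in> Wc" "z \<noteq> 0" for z
    by (rule inner_ge_of_dual[OF c]) (use that h(2) de' in \<open>auto simp: local_normals_def Wc_def\<close>)
  have oc: "Vo \<subseteq> Vc" "Wo \<subseteq> Wc"
    by (auto simp: defs)
  have nz: "u0 \<noteq> 0" "w0 \<noteq> 0"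
    using u0 w0 by (auto simp: defs)
  have "0 < h \<bullet> u0" "0 < h \<bullet> w0"
    using u0 w0 oc h_V[of u0] h_W[of w0] nz by blast+
  \<comment> \<open>Both vectors are scaled to the line where \<open>h\<close> equals 1. Then
    \<open>h\<close> vanishes on \<open>u - w\<close>, whereas it is positive on the nonzero vectors
    of either closed cone.\<close>
  define u where "u = (1 / (h \<bullet> u0)) *\<^sub>R u0"
  define w where "w = (1 / (h \<bullet> w0)) *\<^sub>R w0"
  have scale: "c *\<^sub>R z \<in> Vo \<longleftrightarrow> z \<in> Vo" "c *\<^sub>R z \<in> Vc \<longleftrightarrow> z \<in> Vc"
    "c *\<^sub>R z \<in> Wo \<longleftrightarrow> z \<in> Wo" "c *\<^sub>R z \<in> Wc \<longleftrightarrow> z \<in> Wc" if "0 < c" for c z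
    using that by (auto simp: defs zero_less_mult_iff zero_le_mult_iff)
  have u: "u \<in> Vo" "u \<notin> Wc" and w: "w \<in> Wo" "w \<notin> Vc"
    using u0 w0 \<open>0 < h \<bullet> u0\<close> \<open>0 < h \<bullet> w0\<close> by (simp_all add: u_def w_def scale)
  have hu: "h \<bullet> u = 1" and hw: "h \<bullet> w = 1"
    using \<open>0 < h \<bullet> u0\<close> \<open>0 < h \<bullet> w0\<close> by (simp_all add: u_def w_def)
  have "u \<noteq> w"
    using u w oc by auto
  have "open Vo" "open Wo" "closed Vc" "closed Wc"
    unfolding defs by (intro open_Collect_conj open_Collect_less closed_Collect_conj
        closed_Collect_le continuous_intros)+
  then interpret special_pair Vo Vc Wo Wc u w
    using oc scale u w h_V[of "u - w"] h_V[of "w - u"] h_W[of "u - w"] h_W[of "w - u"] \<open>u \<noteq> w\<close> hu hw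
    by unfold_locales (auto simp: inner_diff_right, auto simp: defs)
  obtain r1 where r1: "0 < r1"
    "\<forall>z. norm z < r1 \<longrightarrow> 0 < b1 \<bullet> z \<and> 0 < b2 \<bullet> z \<longrightarrow> x + z \<in> inside G"
    "\<forall>z. norm z < r1 \<longrightarrow> \<not> (0 \<le> b1 \<bullet> z \<and> 0 \<le> b2 \<bullet> z) \<longrightarrow> x + z \<notin> G \<union> inside G"
    by (rule local_shape[OF x de b])
  obtain r2 where r2: "0 < r2"
    "\<forall>z. norm z < r2 \<longrightarrow> 0 < c1 \<bullet> z \<and> 0 < c2 \<bullet> z \<longrightarrow> y + z \<in> inside G"
    "\<forall>z. norm z < r2 \<longrightarrow> \<not> (0 \<le> c1 \<bullet> z \<and> 0 \<le> c2 \<bullet> z) \<longrightarrow> y + z \<notin> G \<union> inside G"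
    by (rule local_shape[OF y de' c])
  have P_sub: "inside G \<subseteq> P" "P \<subseteq> G \<union> inside G"
    using P by auto
  show ?thesis
  proof (rule not_totally_cover_decomposable)
    show "bounded P"
      using P Jordan(3) compact_imp_bounded[OF compact_G] by auto
    show "P \<noteq> {}"
      using P Jordan(1) by auto
    show "0 < min r1 r2"
      using r1(1) r2(1) by simp
  next
    fix z assume "norm z < min r1 r2" "z \<in> Vo"
    then show "x + z \<in> P"
      using spec[OF r1(2), of z] P_sub by (auto simp: Vo_def)
  next
    fix z assume "norm z < min r1 r2" "z \<notin> Vc"
    then show "x + z \<notin> P"
      using spec[OF r1(3), of z] P_sub unfolding Vc_def by auto
  next
    fix z assume "norm z < min r1 r2" "z \<in> Wo"
    then show "y + z \<in> P"
      using spec[OF r2(2), of z] P_sub by (auto simp: Wo_def)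
  next
    fix z assume "norm z < min r1 r2" "z \<notin> Wc"
    then show "y + z \<notin> P"
      using spec[OF r2(3), of z] P_sub unfolding Wc_def by auto
  qed
qed

text \<open>Supporting sides keep \<open>G\<close> off the interior of the convex hull of
  \<open>V\<close>. This interior is connected and contains the inside of \<open>G\<close>, so the
  two coincide.\<close>

lemma convex_of_edges_support:
  assumes supp: "\<And>x y. x \<in> V \<Longrightarrow> y \<in> nb x \<Longrightarrow> \<exists>a. a \<noteq> 0 \<and> a \<bullet> (y - x) = 0 \<and> supports a x"
  shows "convex (inside G)" "convex (G \<union> inside G)"
proof -
  define K where "K = convex hull V"
  have K: "convex K" "V \<subseteq> K"
    by (simp_all add: K_def hull_subset)
  have "G \<subseteq> K"
    unfolding G_eq
  proof (intro UN_least)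
    fix y z assume "y \<in> V" "z \<in> nb y"
    then show "closed_segment y z \<subseteq> K"
      using K nb_subset[of y] by (intro closed_segment_subset) auto
  qed
  have "z \<notin> interior K" if "z \<in> G" for z
  proof
    assume z: "z \<in> interior K"
    obtain x y where xy: "x \<in> V" "y \<in> nb x" "z \<in> closed_segment x y"
      using \<open>z \<in> G\<close> by (auto simp: G_eq)
    obtain a where a: "a \<noteq> 0" "a \<bullet> (y - x) = 0" "supports a x"
      using supp[OF xy(1,2)] by blast
    have "V \<subseteq> {p. a \<bullet> p \<ge> a \<bullet> x}"
      using a(3) by (auto simp: supports_def inner_diff_right)
    then have "K \<subseteq> {p. a \<bullet> p \<ge> a \<bullet> x}"
      unfolding K_def by (intro hull_minimal convex_halfspace_ge)
    then have "a \<bullet> x < a \<bullet> z"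
      using z interior_mono interior_halfspace_ge[OF a(1), of "a \<bullet> x"] by blast
    moreover obtain t where "z = (1 - t) *\<^sub>R x + t *\<^sub>R y"
      using xy(3) by (auto simp: in_segment)
    then have "z = x + t *\<^sub>R (y - x)"
      by (simp add: algebra_simps)
    then have "a \<bullet> z = a \<bullet> x"
      using a(2) by (simp add: inner_add_right)
    ultimately show False by simp
  qed
  then have disj: "interior K \<inter> G = {}" by blast
  have "inside G \<subseteq> interior K"
    using inside_subset_convex_superset[OF K(1) \<open>G \<subseteq> K\<close>] Jordan(2) by (rule interior_maximal)
  moreover have "interior K \<subseteq> inside G"
  proof
    fix q assume "q \<in> interior K"
    then show "q \<in> inside G"
      using connected_disjoint_inside[OF convex_connected[OF convex_interior[OF K(1)]] disj, of q]
        \<open>inside G \<subseteq> interior K\<close> Jordan(1) by blast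
  qed
  ultimately have "inside G = interior K" by blast
  then show "convex (inside G)"
    using K(1) by (simp add: convex_interior)
  then have "convex (closure (inside G))"
    by (rule convex_closure)
  moreover have "closure (inside G) = G \<union> inside G"
    using closure_Un_frontier[of "inside G"] Jordan(4) by auto
  ultimately show "convex (G \<union> inside G)" by simp
qed

theorem indecomposable_of_not_convex:
  assumes P: "P = inside G \<or> P = G \<union> inside G" and "\<not> convex P"
  shows "\<not> totally_cover_decomposable P"
proof
  assume tcd: "totally_cover_decomposable P"
  have nested: "local_normals x \<subseteq> local_normals y \<or> local_normals y \<subseteq> local_normals x"
    if "x \<in> V" "y \<in> V" "global_normals x \<noteq> {}" "global_normals y \<noteq> {}"
      "local_normals x \<inter> local_normals y \<noteq> {}" for x y
    using indecomposable_of_crossing_normals[OF that(1,3,2,4,5) _ _ P] tcd by blast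
  have "\<exists>a. a \<noteq> 0 \<and> a \<bullet> (y - x) = 0 \<and> supports a x" if "x \<in> V" "y \<in> nb x" for x y
    using edges_support[OF nested that] by blast
  then show False
    using convex_of_edges_support assms by blast
qed

end

section \<open>Polygons given by vertex lists\<close>

lemma pathstart_polygonal_path: "xs \<noteq> [] \<Longrightarrow> pathstart (polygonal_path xs) = hd xs"
  by (induction xs rule: polygonal_path.induct) auto

lemma pathfinish_polygonal_path: "xs \<noteq> [] \<Longrightarrow> pathfinish (polygonal_path xs) = last xs"
  by (induction xs rule: polygonal_path.induct) auto

lemma path_image_polygonal_path:
  "2 \<le> length xs \<Longrightarrow>
    path_image (polygonal_path xs) = (\<Union>i<length xs - 1. closed_segment (xs ! i) (xs ! Suc i))"
proof (induction xs rule: polygonal_path.induct)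
  case (4 a b c vs)
  have "pathfinish (linepath a b) = pathstart (polygonal_path (b # c # vs))"
    by (simp add: pathstart_polygonal_path)
  then show ?case
    using 4 by (simp add: path_image_join lessThan_Suc_eq_insert_0 image_image)
qed (auto simp: lessThan_Suc)

lemma set_subset_path_image_polygonal_path:
  assumes "2 \<le> length xs"
  shows "set xs \<subseteq> path_image (polygonal_path xs)"
proof
  fix x assume "x \<in> set xs"
  then obtain i where i: "i < length xs" "x = xs ! i"
    by (auto simp: in_set_conv_nth)
  show "x \<in> path_image (polygonal_path xs)"
  proof (cases "Suc i < length xs")
    case True
    then show ?thesis
      using i assms by (auto simp: path_image_polygonal_path intro!: bexI[of _ i])
  next
    case False
    then have "x \<in> closed_segment (xs ! (i - 1)) (xs ! Suc (i - 1))" "i - 1 < length xs - 1"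
      using i assms by auto
    then show ?thesis
      using assms by (auto simp: path_image_polygonal_path)
  qed
qed

text \<open>The first segment meets the rest of the arc only in \<open>b\<close>. Hence
  \<open>a\<close> is off all later segments, and no later vertex except \<open>b\<close> is on the
  first.\<close>

lemma arc_polygonal_path:
  assumes "arc (polygonal_path xs)" "2 \<le> length xs"
  shows "distinct xs \<and> (\<forall>x\<in>set xs. \<forall>j. Suc j < length xs \<longrightarrow>
    x \<in> closed_segment (xs ! j) (xs ! Suc j) \<longrightarrow> x = xs ! j \<or> x = xs ! Suc j)"
  using assms
proof (induction xs rule: polygonal_path.induct)
  case (3 a b)
  then show ?case
    using arc_distinct_ends[of "linepath a b"] by auto
next
  case (4 a b c vs)
  let ?ys = "b # c # vs"
  have "pathfinish (linepath a b) = pathstart (polygonal_path ?ys)"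
    by (simp add: pathstart_polygonal_path)
  then have arcs: "arc (linepath a b)" "arc (polygonal_path ?ys)"
    and meet: "closed_segment a b \<inter> path_image (polygonal_path ?ys) \<subseteq> {b}"
    using 4(2) arc_join_eq[of "linepath a b" "polygonal_path ?ys"]
    by (auto simp: pathstart_polygonal_path)
  have IH: "distinct ?ys" "\<And>x j. x \<in> set ?ys \<Longrightarrow> Suc j < length ?ys \<Longrightarrow>
      x \<in> closed_segment (?ys ! j) (?ys ! Suc j) \<Longrightarrow> x = ?ys ! j \<or> x = ?ys ! Suc j"
    using 4(1)[OF arcs(2)] by auto
  have "a \<noteq> b"
    using arc_distinct_ends[OF arcs(1)] by simp
  then have a: "a \<notin> path_image (polygonal_path ?ys)"
    using meet by auto
  have sub: "set ?ys \<subseteq> path_image (polygonal_path ?ys)"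
    by (rule set_subset_path_image_polygonal_path) simp
  have "x = (a # ?ys) ! j \<or> x = (a # ?ys) ! Suc j"
    if x: "x \<in> set (a # ?ys)" and j: "Suc j < length (a # ?ys)"
      and seg: "x \<in> closed_segment ((a # ?ys) ! j) ((a # ?ys) ! Suc j)" for x j
  proof (cases j)
    case 0
    then show ?thesis
      using x seg sub meet by auto
  next
    case (Suc i)
    have i: "Suc i < length ?ys" "x \<in> closed_segment (?ys ! i) (?ys ! Suc i)"
      using j seg Suc by auto
    then have "x \<in> path_image (polygonal_path ?ys)"
      by (subst path_image_polygonal_path) auto
    then have "x \<in> set ?ys"
      using x a by auto
    then show ?thesis
      using IH(2)[of x i] i Suc by simp
  qed
  moreover have "distinct (a # ?ys)"
    using IH(1) a sub by auto
  ultimately show ?case by blast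
qed auto

section \<open>Simple polygons as cyclic graphs\<close>

context
  fixes vs :: "complex list"
  assumes simple: "simple_polygon vs"
begin

lemma length_simple_polygon: "3 \<le> length vs"
  using simple by (simp add: simple_polygon_def)

lemma hd_simple_polygon: "hd vs = vs ! 0"
  using length_simple_polygon by (intro hd_conv_nth) auto

lemma closed_polygon_boundary:
  "pathfinish (polygon_boundary vs) = pathstart (polygon_boundary vs)"
  by (simp add: polygon_boundary_def pathstart_polygonal_path pathfinish_polygonal_path)
    (metis hd_append2 length_simple_polygon list.size(3) not_numeral_le_zero)

lemma nth_rotated:
  assumes "i < length vs"
  shows "(tl vs @ [hd vs]) ! i = vs ! (Suc i mod length vs)"
  using assms length_simple_polygon
  by (cases "Suc i = length vs") (auto simp: nth_append nth_tl hd_simple_polygon)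

lemma path_image_polygon_boundary:
  "path_image (polygon_boundary vs) =
    (\<Union>i<length vs. closed_segment (vs ! i) (vs ! (Suc i mod length vs)))"
proof -
  have nth: "(vs @ [hd vs]) ! Suc i = vs ! (Suc i mod length vs)" if "i < length vs" for i
    using that length_simple_polygon
    by (cases "Suc i = length vs") (auto simp: nth_append hd_simple_polygon)
  show ?thesis
    unfolding polygon_boundary_def using length_simple_polygon
    by (subst path_image_polygonal_path) (auto simp: nth nth_append_left)
qed

text \<open>Cutting the first side out of the loop leaves the arc through \<open>ws\<close>, which
  ends at the first vertex; the side meets it only in its own endpoints.\<close>

lemma simple_polygon_vertices:
  shows "distinct vs"
    and "\<And>x j. x \<in> set vs \<Longrightarrow> j < length vs \<Longrightarrow>
      x \<in> closed_segment (vs ! j) (vs ! (Suc j mod length vs)) \<Longrightarrow>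
      x = vs ! j \<or> x = vs ! (Suc j mod length vs)"
proof -
  obtain a b c us where vs: "vs = a # b # c # us"
    using length_simple_polygon by (metis (no_types) Suc_le_length_iff numeral_3_eq_3)
  define ws where "ws = tl vs @ [hd vs]"
  have ws: "ws = b # c # us @ [a]" "length ws = length vs" "set ws = set vs" "2 \<le> length ws"
    by (auto simp: ws_def vs)
  have ends: "pathstart (polygonal_path ws) = b" "pathfinish (polygonal_path ws) = a"
    using ws(1) by (simp_all add: pathstart_polygonal_path pathfinish_polygonal_path)
  have "polygon_boundary vs = linepath a b +++ polygonal_path ws"
    by (simp add: polygon_boundary_def vs ws(1))
  then have arc: "arc (polygonal_path ws)"
    and meet: "closed_segment a b \<inter> path_image (polygonal_path ws) \<subseteq> {a, b}"
    using simple simple_path_join_loop_eq[of "polygonal_path ws" "linepath a b"] ends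
    by (auto simp: simple_polygon_def)
  note ws_arc = arc_polygonal_path[OF arc ws(4)]
  show "distinct vs"
    using ws_arc by (auto simp: ws(1) vs)
  fix x j
  assume x: "x \<in> set vs" and j: "j < length vs"
    and seg: "x \<in> closed_segment (vs ! j) (vs ! (Suc j mod length vs))"
  show "x = vs ! j \<or> x = vs ! (Suc j mod length vs)"
  proof (cases j)
    case 0
    have "x \<in> path_image (polygonal_path ws)"
      using set_subset_path_image_polygonal_path[OF ws(4)] x ws(3) by blast
    then show ?thesis
      using seg meet 0 by (auto simp: vs)
  next
    case (Suc i)
    have "ws ! i = vs ! j" "ws ! Suc i = vs ! (Suc j mod length vs)"
      using nth_rotated[of i] nth_rotated[of "Suc i"] j Suc by (simp_all add: ws_def)
    then show ?thesis
      using ws_arc x seg j Suc ws(2,3) by metis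
  qed
qed

text \<open>Adjacency is stated for points, as the graph locale requires, and is symmetric by
  construction; indices can be recovered because the vertices are distinct.\<close>

definition polygon_nb :: "complex \<Rightarrow> complex set" where
  "polygon_nb x = {y. \<exists>i<length vs. (x, y) = (vs ! i, vs ! (Suc i mod length vs)) \<or>
      (y, x) = (vs ! i, vs ! (Suc i mod length vs))}"

lemma polygon_nb_nth:
  assumes "k < length vs"
  shows "polygon_nb (vs ! k) =
    {vs ! (Suc k mod length vs), vs ! (if k = 0 then length vs - 1 else k - 1)}" (is "_ = {?s, ?p}")
proof -
  let ?n = "length vs"
  have eq: "vs ! i = vs ! j \<longleftrightarrow> i = j" if "i < ?n" "j < ?n" for i j
    using that simple_polygon_vertices(1) by (simp add: nth_eq_iff_index_eq)
  have lt: "Suc i mod ?n < ?n" for i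
    using assms by (intro mod_less_divisor) auto
  have pred: "Suc i mod ?n = k \<longleftrightarrow> i = (if k = 0 then ?n - 1 else k - 1)" if "i < ?n" for i
    using that assms by (auto simp: mod_Suc)
  have "polygon_nb (vs ! k) = {y. y = ?s \<or> (\<exists>i<?n. y = vs ! i \<and> Suc i mod ?n = k)}"
    using assms lt by (auto simp: polygon_nb_def eq)
  also have "\<dots> = {?s, ?p}"
    using assms by (auto simp: pred cong: conj_cong)
  finally show ?thesis .
qed

lemma side_of_polygon_nb:
  assumes "y \<in> polygon_nb x"
  obtains i \<sigma> where "i < length vs" "y - x = (\<sigma> :: real) *\<^sub>R side_vector vs i" "\<sigma> = 1 \<or> \<sigma> = -1"
    "{x, y} = {vs ! i, vs ! (Suc i mod length vs)}"
proof -
  obtain i where i: "i < length vs"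
    "(x, y) = (vs ! i, vs ! (Suc i mod length vs)) \<or> (y, x) = (vs ! i, vs ! (Suc i mod length vs))"
    using assms by (auto simp: polygon_nb_def)
  from i(2) show ?thesis
    using that[of i 1] that[of i "- 1"] i(1) by (auto simp: side_vector_def)
qed

lemma polygon_curve_simple_polygon:
  assumes "no_two_parallel_sides vs"
  shows "polygon_curve (set vs) polygon_nb (path_image (polygon_boundary vs))"
proof
  let ?n = "length vs" and ?c = "polygon_boundary vs"
  note n = length_simple_polygon
  have nth_eq: "vs ! i = vs ! j \<longleftrightarrow> i = j" if "i < ?n" "j < ?n" for i j
    using that simple_polygon_vertices(1) by (simp add: nth_eq_iff_index_eq)
  have lt: "Suc i mod ?n < ?n" for i
    using n by (intro mod_less_divisor) auto
  show "finite (set vs)" "set vs \<noteq> {}"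
    using n by auto
  show "\<exists>a b. a \<in> set vs \<and> b \<in> set vs \<and> polygon_nb x = {a, b} \<and> a \<noteq> b" if x: "x \<in> set vs" for x
  proof -
    obtain k where k: "k < ?n" "x = vs ! k"
      using x by (metis in_set_conv_nth)
    let ?p = "if k = 0 then ?n - 1 else k - 1"
    have p: "?p < ?n" "Suc k mod ?n \<noteq> ?p"
      using n k(1) by (auto simp: mod_Suc)
    show ?thesis
      unfolding k(2) polygon_nb_nth[OF k(1)]
      using p lt[of k] nth_eq[OF lt[of k] p(1)]
      by (intro exI[of _ "vs ! (Suc k mod ?n)"] exI[of _ "vs ! ?p"] conjI nth_mem refl) blast+
  qed
  show "x \<notin> polygon_nb x" if x: "x \<in> set vs" for x
  proof -
    obtain k where k: "k < ?n" "x = vs ! k"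
      using x by (metis in_set_conv_nth)
    let ?p = "if k = 0 then ?n - 1 else k - 1"
    have p: "?p < ?n" "k \<noteq> Suc k mod ?n" "k \<noteq> ?p"
      using n k(1) by (auto simp: mod_Suc)
    show ?thesis
      unfolding k(2) polygon_nb_nth[OF k(1)]
      using p(2,3) nth_eq[OF k(1) lt[of k]] nth_eq[OF k(1) p(1)] by blast
  qed
  show "{x, y} = {x', y'}"
    if xy: "y \<in> polygon_nb x" "y' \<in> polygon_nb x'" "y - x = c *\<^sub>R (y' - x')" for x x' y y' c
  proof -
    obtain i \<sigma> where i: "i < ?n" "y - x = (\<sigma> :: real) *\<^sub>R side_vector vs i" "\<sigma> = 1 \<or> \<sigma> = -1"
      "{x, y} = {vs ! i, vs ! (Suc i mod ?n)}"
      by (rule side_of_polygon_nb[OF xy(1)])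
    obtain j \<tau> where j: "j < ?n" "y' - x' = (\<tau> :: real) *\<^sub>R side_vector vs j" "\<tau> = 1 \<or> \<tau> = -1"
      "{x', y'} = {vs ! j, vs ! (Suc j mod ?n)}"
      by (rule side_of_polygon_nb[OF xy(2)])
    have "side_vector vs i = (\<sigma> * \<sigma>) *\<^sub>R side_vector vs i"
      using i(3) by auto
    also have "\<dots> = (\<sigma> * c * \<tau>) *\<^sub>R side_vector vs j"
      using xy(3) i(2) j(2) by (metis scaleR_scaleR)
    finally have "i = j"
      using assms i(1) j(1) by (auto simp: no_two_parallel_sides_def)
    then show ?thesis
      using i(4) j(4) by simp
  qed
  show "U = set vs"
    if U: "U \<subseteq> set vs" "U \<noteq> {}" "\<And>x. x \<in> U \<Longrightarrow> polygon_nb x \<subseteq> U" for U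
  proof -
    obtain k where k: "k < ?n" "vs ! k \<in> U"
      using U(1,2) by (metis all_not_in_conv in_set_conv_nth subsetD)
    \<comment> \<open>Walking forward from \<open>vs ! k\<close> never leaves \<open>U\<close>;
      taking \<open>?n - k + i\<close> steps leads to index \<open>i\<close> modulo
      \<open>?n\<close>.\<close>
    have reach: "vs ! ((k + m) mod ?n) \<in> U" for m
    proof (induction m)
      case 0
      then show ?case using k by simp
    next
      case (Suc m)
      have "(k + m) mod ?n < ?n"
        using k(1) by (intro mod_less_divisor) auto
      then have "vs ! (Suc ((k + m) mod ?n) mod ?n) \<in> polygon_nb (vs ! ((k + m) mod ?n))"
        by (auto simp: polygon_nb_def)
      then show ?case
        using U(3)[OF Suc] by (auto simp: mod_Suc_eq)
    qed
    have "vs ! i \<in> U" if "i < ?n" for i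
      using reach[of "?n - k + i"] k(1) that by simp
    then show ?thesis
      using U(1) by (auto simp: in_set_conv_nth)
  qed
  show "path_image ?c = (\<Union>x\<in>set vs. \<Union>y\<in>polygon_nb x. closed_segment x y)" (is "_ = ?R")
  proof
    show "path_image ?c \<subseteq> ?R"
      unfolding path_image_polygon_boundary by (force simp: polygon_nb_def)
    show "?R \<subseteq> path_image ?c"
      unfolding path_image_polygon_boundary
      by (auto simp: polygon_nb_def) (metis closed_segment_commute lessThan_iff)+
  qed
  show "x \<in> polygon_nb y" if "y \<in> polygon_nb x" for x y
    using that by (auto simp: polygon_nb_def)
  show "x = y \<or> x = z" if "x \<in> set vs" "z \<in> polygon_nb y" "x \<in> closed_segment y z" for x y z
    using that simple_polygon_vertices(2)[OF that(1)] by (auto simp: polygon_nb_def closed_segment_commute; blast)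
  have simp_c: "simple_path ?c"
    using simple by (simp add: simple_polygon_def)
  note J = Jordan_inside_outside[OF simp_c closed_polygon_boundary]
  show "inside (path_image ?c) \<noteq> {}" "open (inside (path_image ?c))" "bounded (inside (path_image ?c))"
    "frontier (inside (path_image ?c)) = path_image ?c"
    using J by auto
  show "compact (path_image ?c)"
    using simp_c by (simp add: compact_path_image simple_path_imp_path)
qed

end

theorem theoremE:
  fixes vs :: "complex list" and P :: "complex set"
  assumes "simple_polygon vs"
    and "P = open_polygon vs \<or> P = closed_polygon vs"
    and "\<not> convex P"
    and "no_two_parallel_sides vs"
  shows "\<not> totally_cover_decomposable P"
  using polygon_curve.indecomposable_of_not_convex[OF polygon_curve_simple_polygon[OF assms(1,4)]]
    assms(2,3) by (auto simp: open_polygon_def closed_polygon_def)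

end
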